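(* Let $m=2k+1$ with $k\in\mathbb{N}$, $\mu\in\{-1,1\}$, and consider the odd-order equation $$\frac{\partial u(t,x)}{\partial t}=\mu\frac{\partial^m u(t,x)}{\partial x^m},\qquad t>0,\ x\in\mathbb{R},$$ with random initial condition $u(0,x)=\eta(x)=M(x)+\xi(x)$, whose solution field is taken to be $$u(t,x)=\int_{\mathbb{R}}M(x-y)\,u_m(t,y)\,dy+\frac{1}{2\pi}\int_{\mathbb{R}}e^{i\lambda x+i\mu(-1)^{\frac{m-1}{2}}\lambda^m t}\sqrt{f(\lambda)}\,W(d\lambda),$$ where $u_m(t,y)=\frac{1}{2\pi}\int_{\mathbb{R}}e^{-i\lambda y-i\mu(-1)^{\frac{m-1}{2}}t\lambda^m}d\lambda$. Suppose the covariance function of $\xi$ satisfies Assumption B with $A_0=0$. For $\varepsilon>0$ define the kernel-averaged rescaled field $$\overline U^g_\varepsilon(t,x)=\varepsilon^{-1/4}\left[\int_{\mathbb{R}}e^{-(x_1-x)^2}u\big(t\varepsilon^{-m/2},x_1\varepsilon^{-1/2}\big)dx_1-\mathbb{E}\int_{\mathbb{R}}e^{-(x_1-x)^2}u\big(t\varepsilon^{-m/2},x_1\varepsilon^{-1/2}\big)dx_1\right].$$ Then, as $\varepsilon\to0$, the finite-dimensional distributions of $\overline U^g_\varepsilon$ converge weakly to those of the zero-mean Gaussian random field $$U^g_0(t,x)=\frac{\sqrt{C}}{2\sqrt{\pi}}\int_{\mathbb{R}}e^{i(\lambda x+\mu(-1)^{\frac{m-1}{2}}\lambda^m t)}e^{-\lambda^2/4}\,W(d\lambda),\qquad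 C:=\sum_{j=1}^n c_1(\kappa_j)A_jK_{\frac{\kappa_j-1}{2}}(|w_j|)\,|w_j|^{\frac{\kappa_j-1}{2}},$$ with covariance function $$\operatorname{Cov}(U^g_0(t,x),U^g_0(t',x'))=\frac{C}{4\pi}\int_{\mathbb{R}}\cos\!\Big(\lambda(x-x')+\mu(-1)^{\frac{m-1}{2}}(t-t')\lambda^m\Big)e^{-\lambda^2/2}\,d\lambda.$$
   Context: $(\Omega,\mathscr F,\mathbb P)$ is a complete probability space. $M:\mathbb{R}\to\mathbb{R}$ is a deterministic function for which the convolution integrals above are well defined. $\xi(x)$, $x\in\mathbb{R}$, is a real-valued, measurable, mean-square continuous, stationary Gaussian process with $\mathbb{E}\xi(x)=0$, $\mathbb{E}\xi^2(x)=1$, absolutely continuous spectral measure with spectral density $f$, and spectral representation $\xi(x)=\int_{\mathbb{R}}e^{i\lambda x}\sqrt{f(\lambda)}\,W(d\lambda)$, where $W$ is a complex Gaussian white-noise random measure on $\mathbb{R}$ chosen symmetric about the origin (so that all fields are real-valued), integrals being understood in $L_2(\Omega)$. Assumption B: the covariance function of $\xi$ is $r(x)=\sum_{j=0}^n A_j\frac{\cos(w_jx)}{(1+x^2)^{\kappa_j/2}}$, $x\in\mathbb{R}$, where $A_j\ge0$, $\sum_{j=0}^nA_j=1$, $w_0=0$, $w_j\neq0$ for $j\ge1$, and $\kappa_j\in(0,1)$ for $j=0,\dots,n$. Its spectral density is $$f(\lambda)=\sum_{j=0}^n\frac{c_1(\kappa_j)}{2}A_j\left(\frac{K_{\frac{\kappa_j-1}{2}}(|\lambda+w_j|)}{|\lambda+w_j|^{\frac{1-\kappa_j}{2}}}+\frac{K_{\frac{\kappa_j-1}{2}}(|\lambda-w_j|)}{|\lambda-w_j|^{\frac{1-\kappa_j}{2}}}\right),$$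 with $c_1(\kappa)=2^{\frac{1-\kappa}{2}}/(\sqrt{\pi}\,\Gamma(\kappa/2))$ and $K_\nu$ the modified Bessel function of the second kind. *)

theory Defs
  imports "HOL-Probability.Probability"
begin

(* Modified Bessel function of the second kind, via its standard integral
   representation K_nu(z) = int_0^infty exp(-z cosh s) cosh(nu s) ds  (z > 0). *)
definition besselK :: "real \<Rightarrow> real \<Rightarrow> real" where
  "besselK \<nu> z = set_lebesgue_integral lborel {0..} (\<lambda>s. exp (- z * cosh s) * cosh (\<nu> * s))"

definition c1 :: "real \<Rightarrow> real" where
  "c1 \<kappa> = 2 powr ((1 - \<kappa>) / 2) / (sqrt pi * Gamma (\<kappa> / 2))"

(* spectral density under Assumption B *)
definition specdens :: "nat \<Rightarrow> (nat \<Rightarrow> real) \<Rightarrow> (nat \<Rightarrow> real) \<Rightarrow> (nat \<Rightarrow> real) \<Rightarrow> real \<Rightarrow> real" where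
  "specdens n A w \<kappa> l = (\<Sum>j=0..n. c1 (\<kappa> j) / 2 * A j *
      (besselK ((\<kappa> j - 1) / 2) \<bar>l + w j\<bar> / \<bar>l + w j\<bar> powr ((1 - \<kappa> j) / 2)
     + besselK ((\<kappa> j - 1) / 2) \<bar>l - w j\<bar> / \<bar>l - w j\<bar> powr ((1 - \<kappa> j) / 2)))"

definition constC :: "nat \<Rightarrow> (nat \<Rightarrow> real) \<Rightarrow> (nat \<Rightarrow> real) \<Rightarrow> (nat \<Rightarrow> real) \<Rightarrow> real" where
  "constC n A w \<kappa> = (\<Sum>j=1..n. c1 (\<kappa> j) * A j * besselK ((\<kappa> j - 1) / 2) \<bar>w j\<bar>
                                * \<bar>w j\<bar> powr ((\<kappa> j - 1) / 2))"

definition sq_integrable :: "(real \<Rightarrow> complex) \<Rightarrow> bool" where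
  "sq_integrable \<phi> \<longleftrightarrow> \<phi> \<in> borel_measurable borel \<and> integrable lborel (\<lambda>l. (cmod (\<phi> l))\<^sup>2)"

definition real_gaussian_rv :: "'w measure \<Rightarrow> ('w \<Rightarrow> real) \<Rightarrow> bool" where
  "real_gaussian_rv P X \<longleftrightarrow> X \<in> borel_measurable P \<and> (\<exists>\<sigma>\<ge>0. distr P borel X =
      (if \<sigma> = 0 then return borel 0 else density lborel (normal_density 0 \<sigma>)))"

(* Wint phi = int phi(lambda) W(d lambda) for a complex Gaussian white-noise random
   measure W on R, symmetric about the origin (conj W(A) = W(-A)). *)
definition complex_white_noise_integral ::
    "'w measure \<Rightarrow> ((real \<Rightarrow> complex) \<Rightarrow> 'w \<Rightarrow> complex) \<Rightarrow> bool" where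
  "complex_white_noise_integral P I \<longleftrightarrow>
     (\<forall>\<phi>. sq_integrable \<phi> \<longrightarrow> I \<phi> \<in> borel_measurable P \<and> integrable P (\<lambda>\<omega>. (cmod (I \<phi> \<omega>))\<^sup>2)) \<and>
     (\<forall>\<phi> \<psi> a b. sq_integrable \<phi> \<and> sq_integrable \<psi> \<longrightarrow>
        (AE \<omega> in P. I (\<lambda>l. a * \<phi> l + b * \<psi> l) \<omega> = a * I \<phi> \<omega> + b * I \<psi> \<omega>)) \<and>
     (\<forall>\<phi> \<psi>. sq_integrable \<phi> \<and> sq_integrable \<psi> \<longrightarrow>
        integral\<^sup>L P (\<lambda>\<omega>. I \<phi> \<omega> * cnj (I \<psi> \<omega>)) = integral\<^sup>L lborel (\<lambda>l. \<phi> l * cnj (\<psi> l))) \<and>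
     (\<forall>\<phi>. sq_integrable \<phi> \<longrightarrow> (AE \<omega> in P. I (\<lambda>l. cnj (\<phi> (- l))) \<omega> = cnj (I \<phi> \<omega>))) \<and>
     (\<forall>\<phi>. sq_integrable \<phi> \<longrightarrow> real_gaussian_rv P (\<lambda>\<omega>. Re (I \<phi> \<omega>)))"

definition solker :: "real \<Rightarrow> nat \<Rightarrow> nat \<Rightarrow> (nat \<Rightarrow> real) \<Rightarrow> (nat \<Rightarrow> real) \<Rightarrow> (nat \<Rightarrow> real)
                       \<Rightarrow> real \<Rightarrow> real \<Rightarrow> real \<Rightarrow> complex" where
  "solker \<mu> k n A w \<kappa> t x l = complex_of_real (1 / (2 * pi))
      * exp (\<i> * complex_of_real (l * x + \<mu> * (-1) ^ k * l ^ (2 * k + 1) * t))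
      * complex_of_real (sqrt (specdens n A w \<kappa> l))"

definition um :: "real \<Rightarrow> nat \<Rightarrow> real \<Rightarrow> real \<Rightarrow> complex" where
  "um \<mu> k t y = Lim at_top (\<lambda>R::real. complex_of_real (1 / (2 * pi)) *
      set_lebesgue_integral lborel {-R..R}
        (\<lambda>l. exp (- \<i> * complex_of_real (l * y + \<mu> * (-1) ^ k * t * l ^ (2 * k + 1)))))"

definition detpart :: "(real \<Rightarrow> real) \<Rightarrow> real \<Rightarrow> nat \<Rightarrow> real \<Rightarrow> real \<Rightarrow> complex" where
  "detpart M \<mu> k t x = (\<integral>y. complex_of_real (M (x - y)) * um \<mu> k t y \<partial>lborel)"

(* solution field u = deterministic part + random part v (v a measurable version) *)
definition ufield :: "(real \<Rightarrow> real) \<Rightarrow> real \<Rightarrow> nat \<Rightarrow> (real \<Rightarrow> real \<Rightarrow> 'w \<Rightarrow> real)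
                      \<Rightarrow> real \<Rightarrow> real \<Rightarrow> 'w \<Rightarrow> real" where
  "ufield M \<mu> k v t x \<omega> = Re (detpart M \<mu> k t x) + v t x \<omega>"

definition Ubar :: "'w measure \<Rightarrow> (real \<Rightarrow> real) \<Rightarrow> real \<Rightarrow> nat \<Rightarrow> (real \<Rightarrow> real \<Rightarrow> 'w \<Rightarrow> real)
                    \<Rightarrow> real \<Rightarrow> real \<Rightarrow> real \<Rightarrow> 'w \<Rightarrow> real" where
  "Ubar P M \<mu> k v \<epsilon> t x \<omega> = \<epsilon> powr (-1/4) *
     ((\<integral>x1. exp (- (x1 - x)\<^sup>2) * ufield M \<mu> k v (t * \<epsilon> powr (- real (2 * k + 1) / 2)) (x1 * \<epsilon> powr (-1/2)) \<omega> \<partial>lborel)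
      - integral\<^sup>L P (\<lambda>\<omega>'. \<integral>x1. exp (- (x1 - x)\<^sup>2) * ufield M \<mu> k v (t * \<epsilon> powr (- real (2 * k + 1) / 2)) (x1 * \<epsilon> powr (-1/2)) \<omega>' \<partial>lborel))"

definition U0 :: "((real \<Rightarrow> complex) \<Rightarrow> 'w \<Rightarrow> complex) \<Rightarrow> real \<Rightarrow> nat \<Rightarrow> nat \<Rightarrow> (nat \<Rightarrow> real)
                  \<Rightarrow> (nat \<Rightarrow> real) \<Rightarrow> (nat \<Rightarrow> real) \<Rightarrow> real \<Rightarrow> real \<Rightarrow> 'w \<Rightarrow> complex" where
  "U0 I \<mu> k n A w \<kappa> t x = (\<lambda>\<omega>. complex_of_real (sqrt (constC n A w \<kappa>) / (2 * sqrt pi)) *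
      I (\<lambda>l. exp (\<i> * complex_of_real (l * x + \<mu> * (-1) ^ k * l ^ (2 * k + 1) * t))
             * complex_of_real (exp (- l\<^sup>2 / 4))) \<omega>)"

definition covar :: "'w measure \<Rightarrow> ('w \<Rightarrow> real) \<Rightarrow> ('w \<Rightarrow> real) \<Rightarrow> real" where
  "covar P X Y = integral\<^sup>L P (\<lambda>\<omega>. (X \<omega> - integral\<^sup>L P X) * (Y \<omega> - integral\<^sup>L P Y))"

definition weak_conv_vec :: "(real \<Rightarrow> ('a::euclidean_space) measure) \<Rightarrow> 'a measure \<Rightarrow> real filter \<Rightarrow> bool" where
  "weak_conv_vec \<mu>s \<nu> F \<longleftrightarrow> (\<forall>g :: 'a \<Rightarrow> real. continuous_on UNIV g \<and> bounded (range g) \<longrightarrow>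
      ((\<lambda>e. integral\<^sup>L (\<mu>s e) g) \<longlongrightarrow> integral\<^sup>L \<nu> g) F)"

end

theory Submission
  imports Defs "HOL-Real_Asymp.Real_Asymp"
begin

text \<open>
  By a stochastic Fubini argument the averaged field is again a white-noise integral, with kernel a unimodular
  factor times \<open>\<epsilon> powr (-1/4) / (2 * sqrt pi) * exp (- l\<^sup>2 / (4 * \<epsilon>)) * sqrt (f l)\<close>, so every linear
  combination of its values is a centred Gaussian variable. Substituting \<open>l = sqrt \<epsilon> * \<lambda>\<close> in the variance
  turns \<open>f l\<close> into \<open>f (sqrt \<epsilon> * \<lambda>)\<close>. Since \<open>A 0 = 0\<close>, the integrable density \<open>f\<close> has all its singularities
  away from the origin, so these variances converge to the ones with \<open>f\<close> replaced by \<open>f 0 = C\<close>.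
  Convergence of \<open>E cos (u \<bullet> X + b)\<close> for all \<open>u, b\<close> and bounded second moments give weak convergence, because on a large
  cube a bounded continuous function is uniformly close to a polynomial in the functions
  \<open>sin (a * x\<^sub>i)\<close>, i.e. to a trigonometric polynomial.
\<close>

subsection \<open>Weak convergence from trigonometric polynomials\<close>

text \<open>Time and space are rescaled so that the phase
  \<open>l * x + \<mu> * (-1) ^ k * l ^ (2 * k + 1) * t\<close> keeps its form and only has its
  frequency dilated. Dispersion thus never produces decay: after the substitution the waves are the
  same for every \<epsilon> and enter as a bounded factor. What remains is an integral of a Gaussian
  against \<open>f (sqrt \<epsilon> * l)\<close>. Dominated convergence does not apply directly,
  since \<open>f\<close> is unbounded near frequencies \<open>w j\<close> with
  \<open>A j > 0\<close>; but these singularities recede like \<open>1 / sqrt \<epsilon>\<close>,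
  where the Gaussian is far smaller than the mass of the dilated \<open>f\<close> is large.

  The noise is known only through linearity, isometry, symmetry and the Gaussian law of the real
  part of each single integral, and \<open>v\<close> is a version of the field at each fixed point
  separately. Hence joint laws are reached through linear combinations, and the integral over
  \<open>x1\<close> is exchanged with the noise by an orthogonality argument in the space of
  square-integrable variables instead of an approximation of the stochastic integral.\<close>

inductive trig_poly :: "('a::real_inner \<Rightarrow> real) \<Rightarrow> bool" where
  cos: "trig_poly (\<lambda>x. c * cos (u \<bullet> x + b))"
| add: "trig_poly p \<Longrightarrow> trig_poly q \<Longrightarrow> trig_poly (\<lambda>x. p x + q x)"

lemma trig_poly_const: "trig_poly (\<lambda>x. c)"
  using trig_poly.cos[of c 0 0] by simp

lemma trig_poly_sum: "(\<And>i. i \<in> S \<Longrightarrow> trig_poly (p i)) \<Longrightarrow> trig_poly (\<lambda>x. \<Sum>i\<in>S. p i x)"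
  by (induction S rule: infinite_finite_induct) (auto intro: trig_poly_const trig_poly.add)

text \<open>Product-to-sum formula. The free phase \<open>b\<close> in \<open>trig_poly\<close>
  makes sines a special case, so this one identity gives closure under all products.\<close>

lemma trig_poly_cos_mult:
  assumes "trig_poly p"
  shows "trig_poly (\<lambda>x. c * cos (u \<bullet> x + b) * p x)"
  using assms
proof induction
  case (cos d v e)
  have "(\<lambda>x. c * cos (u \<bullet> x + b) * (d * cos (v \<bullet> x + e)))
      = (\<lambda>x. (c * d / 2) * cos ((u - v) \<bullet> x + (b - e)) + (c * d / 2) * cos ((u + v) \<bullet> x + (b + e)))"
    (is "?l = ?r")
  proof
    fix x
    have "(u - v) \<bullet> x + (b - e) = (u \<bullet> x + b) - (v \<bullet> x + e)"
      "(u + v) \<bullet> x + (b + e) = (u \<bullet> x + b) + (v \<bullet> x + e)"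
      by (auto simp: inner_diff_left inner_add_left)
    then show "?l x = ?r x"
      by (simp only: cos_diff cos_add) (simp add: field_simps)
  qed
  then show ?case by (simp only:) (intro trig_poly.intros)
next
  case (add p q)
  then show ?case by (simp add: distrib_left trig_poly.add)
qed

lemma trig_poly_mult:
  assumes "trig_poly p" "trig_poly q"
  shows "trig_poly (\<lambda>x. p x * q x)"
  using assms
proof induction
  case (cos c u b)
  then show ?case by (rule trig_poly_cos_mult)
next
  case (add p q)
  then show ?case by (simp add: distrib_right trig_poly.add)
qed

lemma trig_poly_bounded_continuous:
  assumes "trig_poly p"
  shows "continuous_on UNIV p" "\<exists>K. \<forall>x. \<bar>p x\<bar> \<le> K"
  using assms
proof induction
  case (cos c u b)
  { case 1 show ?case by (intro continuous_intros) }
  { case 2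
    have "\<bar>c * cos (u \<bullet> x + b)\<bar> \<le> \<bar>c\<bar>" for x
      by (simp add: abs_mult mult_left_le)
    then show ?case by blast }
next
  case (add p q)
  { case 1 show ?case by (intro continuous_intros add) }
  { case 2
    from add obtain K L where "\<forall>x. \<bar>p x\<bar> \<le> K" "\<forall>x. \<bar>q x\<bar> \<le> L" by blast
    then have "\<forall>x. \<bar>p x + q x\<bar> \<le> K + L" by (meson abs_triangle_ineq add_mono order_trans)
    then show ?case by blast }
qed

text \<open>A linear functional of the vector of sines is a sum of cosines with phase
  \<open>- (pi / 2)\<close>; sums and products then come from the closure rules. This carries a
  Stone-Weierstrass approximation on a cube over to the whole space.\<close>

lemma trig_poly_polynomial_sin:
  fixes p :: "'a::euclidean_space \<Rightarrow> real"
  assumes "real_polynomial_function p"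
  shows "trig_poly (\<lambda>x::'a. p (\<Sum>b\<in>Basis. sin (a * (x \<bullet> b)) *\<^sub>R b))"
  using assms
proof induction
  case (linear f)
  interpret bounded_linear f by fact
  have "f (\<Sum>b\<in>Basis. sin (a * (x \<bullet> b)) *\<^sub>R b) =
      (\<Sum>b\<in>Basis. f b * cos ((a *\<^sub>R b) \<bullet> x + (- (pi / 2))))" for x :: 'a
    by (simp add: sum scale cos_diff inner_commute mult.commute)
  then show ?case by (simp only:) (intro trig_poly_sum trig_poly.cos)
qed (auto intro: trig_poly_const trig_poly.add trig_poly_mult)

lemma (in prob_space) tendsto_expectation_trig_poly:
  fixes X :: "real \<Rightarrow> 'a \<Rightarrow> 'b::euclidean_space"
  assumes X: "\<And>e. X e \<in> borel_measurable M" and Y: "Y \<in> borel_measurable M"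
    and lim: "\<And>u b. ((\<lambda>e. expectation (\<lambda>\<omega>. cos (u \<bullet> X e \<omega> + b)))
                \<longlongrightarrow> expectation (\<lambda>\<omega>. cos (u \<bullet> Y \<omega> + b))) F"
    and p: "trig_poly p"
  shows "((\<lambda>e. expectation (\<lambda>\<omega>. p (X e \<omega>))) \<longlongrightarrow> expectation (\<lambda>\<omega>. p (Y \<omega>))) F"
  using p
proof induction
  case (cos c u b)
  then show ?case by (simp add: tendsto_intros lim)
next
  case (add p q)
  have int: "integrable M (\<lambda>\<omega>. r (Z \<omega>))"
    if r: "trig_poly r" and Z: "Z \<in> borel_measurable M" for r and Z :: "'a \<Rightarrow> 'b"
  proof -
    obtain K where "\<forall>x. \<bar>r x\<bar> \<le> K" using trig_poly_bounded_continuous(2)[OF r] by blast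
    moreover have "(\<lambda>\<omega>. r (Z \<omega>)) \<in> borel_measurable M"
      using borel_measurable_continuous_onI[OF trig_poly_bounded_continuous(1)[OF r]] Z
      by (rule measurable_compose_rev)
    ultimately show ?thesis by (intro integrable_const_bound[of _ K]) auto
  qed
  show ?case
    using tendsto_add[OF add.IH] by (simp add: int add.hyps X Y)
qed

text \<open>The map \<open>S\<close> of coordinatewise sines sends the whole space into the cube
  \<open>?C\<close> and is inverted by arcsines on the ball of radius \<open>R\<close>. A polynomial
  \<open>q\<close> close to \<open>G\<close> on the cube therefore gives \<open>q (S x)\<close>
  close to \<open>g x\<close> on the ball, and never larger than \<open>B + \<delta>\<close>
  anywhere. Off the ball the error \<open>2 * B + \<delta>\<close> is charged to a factor that is at
  least 1 there, in the form Chebyshev's inequality wants.\<close>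

lemma trig_poly_approx:
  fixes g :: "'a::euclidean_space \<Rightarrow> real"
  assumes g: "continuous_on UNIV g" and B: "\<And>x. \<bar>g x\<bar> \<le> B" and "0 < \<delta>" "0 < R"
  obtains p where "trig_poly p" "\<And>x. \<bar>g x - p x\<bar> \<le> \<delta> + (2 * B + \<delta>) * ((norm x)\<^sup>2 / R\<^sup>2)"
proof -
  \<comment> \<open>A quarter period of the sine has length \<open>R\<close>, so
    \<open>arcsin\<close> inverts it on all coordinates of the ball.\<close>
  define a where "a = pi / (2 * R)"
  have a: "a > 0" using \<open>0 < R\<close> by (simp add: a_def)
  let ?C = "cbox (- One) One :: 'a set"
  define G where "G y = g (\<Sum>b\<in>Basis. (arcsin (y \<bullet> b) / a) *\<^sub>R b)" for y :: 'a
  have "continuous_on ?C (\<lambda>y. \<Sum>b\<in>Basis. (arcsin (y \<bullet> b) / a) *\<^sub>R b)"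
    using a by (intro continuous_intros) (auto simp: mem_box)
  then have "continuous_on ?C G"
    unfolding G_def by (rule continuous_on_compose2[OF g]) auto
  then obtain q where q: "real_polynomial_function q" "\<And>y. y \<in> ?C \<Longrightarrow> \<bar>G y - q y\<bar> < \<delta>"
    using Stone_Weierstrass_real_polynomial_function[of ?C G \<delta>] \<open>0 < \<delta>\<close> compact_cbox by blast
  define S where "S x = (\<Sum>b\<in>Basis. sin (a * (x \<bullet> b)) *\<^sub>R b)" for x :: 'a
  have S: "S x \<in> ?C" for x
    by (auto simp: mem_box S_def)
  show thesis
  proof
    show "trig_poly (\<lambda>x. q (S x))"
      unfolding S_def using q(1) by (rule trig_poly_polynomial_sin)
    fix x
    have GB: "\<bar>G y\<bar> \<le> B" for y using B by (simp add: G_def)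
    have B0: "0 \<le> B" using B[of 0] by linarith
    have near: "\<bar>G (S x) - q (S x)\<bar> < \<delta>" using q(2) S by blast
    show "\<bar>g x - q (S x)\<bar> \<le> \<delta> + (2 * B + \<delta>) * ((norm x)\<^sup>2 / R\<^sup>2)"
    proof (cases "norm x \<le> R")
      case True
      have "arcsin (sin (a * (x \<bullet> b))) = a * (x \<bullet> b)" if "b \<in> Basis" for b
      proof (rule arcsin_sin)
        have "\<bar>x \<bullet> b\<bar> \<le> R" using Basis_le_norm[OF that, of x] True by linarith
        then have "\<bar>a * (x \<bullet> b)\<bar> \<le> a * R" using a by (simp add: abs_mult)
        also have "a * R = pi / 2" using \<open>0 < R\<close> by (simp add: a_def)
        finally show "- (pi / 2) \<le> a * (x \<bullet> b)" "a * (x \<bullet> b) \<le> pi / 2" by auto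
      qed
      then have "(\<Sum>b\<in>Basis. (arcsin (S x \<bullet> b) / a) *\<^sub>R b) = (\<Sum>b\<in>Basis. (x \<bullet> b) *\<^sub>R b)"
        using a by (intro sum.cong) (auto simp: S_def)
      then have "G (S x) = g x"
        unfolding G_def by (simp add: euclidean_representation)
      moreover have "0 \<le> (2 * B + \<delta>) * ((norm x)\<^sup>2 / R\<^sup>2)" using B0 \<open>0 < \<delta>\<close> by simp
      ultimately show ?thesis using near by linarith
    next
      case False
      then have "1 \<le> (norm x)\<^sup>2 / R\<^sup>2" using \<open>0 < R\<close> by (simp add: power_mono)
      then have "2 * B + \<delta> \<le> (2 * B + \<delta>) * ((norm x)\<^sup>2 / R\<^sup>2)"
        using B0 \<open>0 < \<delta>\<close> mult_left_mono[of 1 "(norm x)\<^sup>2 / R\<^sup>2" "2 * B + \<delta>"] by simp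
      then show ?thesis using near GB[of "S x"] B[of x] \<open>0 < \<delta>\<close> by linarith
    qed
  qed
qed

text \<open>Bounded second moments take the place of tightness: one trigonometric polynomial
  approximates \<open>g\<close> in mean under all the laws concerned, the limit included.\<close>

lemma (in prob_space) weak_conv_vec_cosI:
  fixes X :: "real \<Rightarrow> 'a \<Rightarrow> 'b::euclidean_space"
  assumes X: "\<And>e. X e \<in> borel_measurable M" and Y: "Y \<in> borel_measurable M"
    and lim: "\<And>u b. ((\<lambda>e. expectation (\<lambda>\<omega>. cos (u \<bullet> X e \<omega> + b)))
                \<longlongrightarrow> expectation (\<lambda>\<omega>. cos (u \<bullet> Y \<omega> + b))) F"
    and X2: "\<forall>\<^sub>F e in F. integrable M (\<lambda>\<omega>. (norm (X e \<omega>))\<^sup>2) \<and> expectation (\<lambda>\<omega>. (norm (X e \<omega>))\<^sup>2) \<le> K"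
    and Y2: "integrable M (\<lambda>\<omega>. (norm (Y \<omega>))\<^sup>2)"
  shows "weak_conv_vec (\<lambda>e. distr M borel (X e)) (distr M borel Y) F"
  unfolding weak_conv_vec_def
proof (intro allI impI, elim conjE)
  fix g :: "'b \<Rightarrow> real"
  assume g: "continuous_on UNIV g" and "bounded (range g)"
  then obtain B where B: "\<And>x. \<bar>g x\<bar> \<le> B" by (auto simp: bounded_real)
  have B0: "0 \<le> B" using B[of 0] by linarith
  have gm: "g \<in> borel_measurable borel" using g by (rule borel_measurable_continuous_onI)
  \<comment> \<open>A common bound for the second moments; the 1 keeps it positive, and with it the
    radius \<open>R\<close>.\<close>
  define L where "L = max 1 (max K (expectation (\<lambda>\<omega>. (norm (Y \<omega>))\<^sup>2)))"
  have L: "L \<ge> 1" "K \<le> L" "expectation (\<lambda>\<omega>. (norm (Y \<omega>))\<^sup>2) \<le> L" by (auto simp: L_def)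
  have "((\<lambda>e. expectation (\<lambda>\<omega>. g (X e \<omega>))) \<longlongrightarrow> expectation (\<lambda>\<omega>. g (Y \<omega>))) F"
  proof (rule tendstoI)
    fix \<eta> :: real assume "0 < \<eta>"
    \<comment> \<open>Two approximation errors of \<open>2 * \<delta>\<close> and one convergence
      error of \<delta> add up to less than \<eta>. The radius \<open>R\<close> is chosen so that
      the quadratic error term has mean at most \<delta>.\<close>
    define \<delta> where "\<delta> = \<eta> / 8"
    define R where "R = sqrt ((2 * B + \<delta>) * L / \<delta>)"
    have \<delta>: "\<delta> > 0" using \<open>0 < \<eta>\<close> by (simp add: \<delta>_def)
    have pos: "(2 * B + \<delta>) * L / \<delta> > 0" using B0 \<delta> L by simp
    then have R: "R > 0" by (simp add: R_def)
    have R2: "(2 * B + \<delta>) * (L / R\<^sup>2) = \<delta>"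
      unfolding R_def using pos B0 \<delta> L by (simp add: field_simps)
    obtain p where p: "trig_poly p" "\<And>x. \<bar>g x - p x\<bar> \<le> \<delta> + (2 * B + \<delta>) * ((norm x)\<^sup>2 / R\<^sup>2)"
      using trig_poly_approx[OF g B \<delta> R] by blast
    obtain Kp where Kp: "\<forall>x. \<bar>p x\<bar> \<le> Kp" using trig_poly_bounded_continuous(2)[OF p(1)] by blast
    have pm: "p \<in> borel_measurable borel"
      using trig_poly_bounded_continuous(1)[OF p(1)] by (rule borel_measurable_continuous_onI)
    have close: "\<bar>expectation (\<lambda>\<omega>. g (Z \<omega>)) - expectation (\<lambda>\<omega>. p (Z \<omega>))\<bar> \<le> 2 * \<delta>"
      if Z[measurable]: "Z \<in> borel_measurable M" and Z2: "integrable M (\<lambda>\<omega>. (norm (Z \<omega>))\<^sup>2)"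
        "expectation (\<lambda>\<omega>. (norm (Z \<omega>))\<^sup>2) \<le> L" for Z
    proof -
      note [measurable] = gm pm
      have ig: "integrable M (\<lambda>\<omega>. g (Z \<omega>))" by (rule integrable_const_bound[of _ B]) (use B in auto)
      have ip: "integrable M (\<lambda>\<omega>. p (Z \<omega>))" by (rule integrable_const_bound[of _ Kp]) (use Kp in auto)
      have "\<bar>expectation (\<lambda>\<omega>. g (Z \<omega>)) - expectation (\<lambda>\<omega>. p (Z \<omega>))\<bar>
          \<le> expectation (\<lambda>\<omega>. \<bar>g (Z \<omega>) - p (Z \<omega>)\<bar>)"
        using integral_norm_bound[of M "\<lambda>\<omega>. g (Z \<omega>) - p (Z \<omega>)"] ig ip by simp
      also have "\<dots> \<le> expectation (\<lambda>\<omega>. \<delta> + (2 * B + \<delta>) * ((norm (Z \<omega>))\<^sup>2 / R\<^sup>2))"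
        using ig ip Z2 by (intro integral_mono p(2) integrable_abs) auto
      also have "\<dots> = \<delta> + (2 * B + \<delta>) * (expectation (\<lambda>\<omega>. (norm (Z \<omega>))\<^sup>2) / R\<^sup>2)"
        using Z2 by (simp add: prob_space)
      also have "\<dots> \<le> \<delta> + (2 * B + \<delta>) * (L / R\<^sup>2)"
        using Z2 B0 \<delta> by (intro add_left_mono mult_left_mono divide_right_mono) auto
      finally show ?thesis using R2 by simp
    qed
    have "\<forall>\<^sub>F e in F. dist (expectation (\<lambda>\<omega>. p (X e \<omega>))) (expectation (\<lambda>\<omega>. p (Y \<omega>))) < \<delta>"
      using tendsto_expectation_trig_poly[OF X Y lim p(1)] \<delta> by (rule tendstoD)
    with X2 show "\<forall>\<^sub>F e in F. dist (expectation (\<lambda>\<omega>. g (X e \<omega>))) (expectation (\<lambda>\<omega>. g (Y \<omega>))) < \<eta>"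
    proof eventually_elim
      case (elim e)
      have *: "\<bar>a - b\<bar> \<le> 2 * \<delta> \<Longrightarrow> \<bar>c - d\<bar> \<le> 2 * \<delta> \<Longrightarrow> \<bar>b - d\<bar> < \<delta> \<Longrightarrow> \<bar>a - c\<bar> < \<eta>" for a b c d
        using \<open>0 < \<eta>\<close> unfolding \<delta>_def by arith
      from elim show ?case
        using close[OF X[of e]] close[OF Y Y2 L(3)] L(2)
        unfolding dist_real_def by (intro *) auto
    qed
  qed
  then show "((\<lambda>e. \<integral>x. g x \<partial>distr M borel (X e)) \<longlongrightarrow> (\<integral>x. g x \<partial>distr M borel Y)) F"
    by (simp add: integral_distr X Y gm)
qed

subsection \<open>The spectral density\<close>

lemma nn_integral_exp_Ici:
  fixes b :: real
  assumes "0 < b"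
  shows "(\<integral>\<^sup>+s. ennreal (indicator {0..} s * exp (- (b * s))) \<partial>lborel) = ennreal (1 / b)"
proof -
  have "(\<integral>\<^sup>+s. ennreal (exp (- (b * s))) * indicator {0..} s \<partial>lborel) = 0 - (- exp (- (b * 0)) / b)"
  proof (rule nn_integral_FTC_atLeast)
    show "DERIV (\<lambda>s. - exp (- (b * s)) / b) s :> exp (- (b * s))" for s
      using assms by (auto intro!: derivative_eq_intros)
    have "((\<lambda>s. - exp (- (b * s)) / b) \<longlongrightarrow> - 0 / b) at_top"
      using assms
      by (intro tendsto_intros filterlim_compose[OF exp_at_bot]
          filterlim_compose[OF filterlim_uminus_at_bot_at_top]
          filterlim_tendsto_pos_mult_at_top[OF tendsto_const _ filterlim_ident]) auto
    then show "((\<lambda>s. - exp (- (b * s)) / b) \<longlongrightarrow> 0) at_top" by simp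
  qed auto
  then show ?thesis by (simp add: ennreal_mult' ennreal_indicator mult.commute)
qed

lemma cosh_ge_half_exp: "exp s / 2 \<le> cosh (s::real)"
  by (simp add: cosh_def)

lemma cosh_mult_le_exp:
  fixes \<nu> s :: real
  assumes "\<bar>\<nu>\<bar> \<le> a" "0 \<le> s"
  shows "cosh (\<nu> * s) \<le> exp (a * s)"
proof -
  have *: "exp (\<nu> * s) \<le> exp (a * s)" "exp (- (\<nu> * s)) \<le> exp (a * s)"
    using assms mult_right_mono[of "\<nu>" a s] mult_right_mono[of "-\<nu>" a s] by auto
  then show ?thesis using add_mono[OF *] by (simp add: cosh_def field_simps del: exp_le_cancel_iff)
qed

text \<open>From \<open>exp (- x) \<le> 2 / x\<^sup>2\<close> at \<open>x = z * exp s / 2\<close>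
  come two factors \<open>exp (- s)\<close>; the hyperbolic cosine uses up one of them. The bound is
  decreasing in \<open>z\<close>, which provides a majorant on any half-line away from 0.\<close>

lemma besselK_integrand_le:
  fixes \<nu> z s :: real
  assumes "0 < z" "\<bar>\<nu>\<bar> \<le> 1" "0 \<le> s"
  shows "exp (- z * cosh s) * cosh (\<nu> * s) \<le> 8 / z\<^sup>2 * exp (- s)"
proof -
  define x where "x = z * (exp s / 2)"
  have x: "0 < x" using assms by (simp add: x_def)
  have "1 + x + x\<^sup>2 / 2 \<le> exp x" using x by (intro exp_lower_Taylor_quadratic) auto
  then have "x\<^sup>2 / 2 \<le> exp x" using x by linarith
  then have "exp (- x) \<le> 2 / x\<^sup>2" using x by (simp add: exp_minus field_simps)
  moreover have "exp (- z * cosh s) \<le> exp (- x)"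
    using assms mult_left_mono[OF cosh_ge_half_exp, of z s] by (simp add: x_def)
  ultimately have "exp (- z * cosh s) \<le> 2 / x\<^sup>2" by linarith
  also have "\<dots> = 8 / z\<^sup>2 * (exp (- s) * exp (- s))"
    using assms by (simp add: x_def exp_minus field_simps power2_eq_square)
  finally have "exp (- z * cosh s) \<le> 8 / z\<^sup>2 * (exp (- s) * exp (- s))" .
  moreover have "cosh (\<nu> * s) \<le> exp s" using cosh_mult_le_exp[of \<nu> 1 s] assms by simp
  ultimately have "exp (- z * cosh s) * cosh (\<nu> * s) \<le> 8 / z\<^sup>2 * (exp (- s) * exp (- s)) * exp s"
    by (intro mult_mono) auto
  also have "\<dots> = 8 / z\<^sup>2 * exp (- s)" by (simp add: exp_minus)
  finally show ?thesis .
qed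

lemma besselK_eq:
  "besselK \<nu> z = (\<integral>s. indicator {0..} s * (exp (- z * cosh s) * cosh (\<nu> * s)) \<partial>lborel)"
  by (simp add: besselK_def set_lebesgue_integral_def)

lemma besselK_nonneg: "0 \<le> besselK \<nu> z"
  unfolding besselK_eq by (intro Bochner_Integration.integral_nonneg) auto

lemma measurable_cosh_real [measurable]: "cosh \<in> borel_measurable (borel :: real measure)"
  by (intro borel_measurable_continuous_onI continuous_intros)

lemma measurable_besselK [measurable]: "besselK \<nu> \<in> borel_measurable borel"
  unfolding besselK_eq[abs_def] by measurable

lemma isCont_besselK:
  assumes z: "0 < z" and \<nu>: "\<bar>\<nu>\<bar> \<le> 1"
  shows "isCont (besselK \<nu>) z"
  unfolding continuous_at_sequentially comp_def
proof (intro allI impI)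
  fix X assume X: "X \<longlonglongrightarrow> z"
  \<comment> \<open>Truncation from below at \<open>z / 2\<close> gives every index the same
    integrable majorant; the truncated sequence agrees with \<open>X\<close> from some index
    on.\<close>
  define Y where "Y i = max (X i) (z / 2)" for i
  have "Y \<longlonglongrightarrow> max z (z / 2)" unfolding Y_def by (intro tendsto_intros X)
  then have Y: "Y \<longlonglongrightarrow> z" using z by simp
  have "(\<lambda>i. besselK \<nu> (Y i)) \<longlonglongrightarrow> besselK \<nu> z"
    unfolding besselK_eq
  proof (rule integral_dominated_convergence)
    let ?w = "\<lambda>s. 8 / (z / 2)\<^sup>2 * (indicator {0..} s * exp (- s)) :: real"
    have "integrable lborel (\<lambda>s. indicator {0..} s * exp (- s) :: real)"
      using nn_integral_exp_Ici[of 1] by (intro integrableI_nonneg) auto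
    then show "integrable lborel ?w" by (rule integrable_mult_right)
    show "AE s in lborel. (\<lambda>i. indicator {0..} s * (exp (- Y i * cosh s) * cosh (\<nu> * s)))
        \<longlonglongrightarrow> indicator {0..} s * (exp (- z * cosh s) * cosh (\<nu> * s))"
      by (intro AE_I2 tendsto_intros Y)
    fix i
    show "AE s in lborel. norm (indicator {0..} s * (exp (- Y i * cosh s) * cosh (\<nu> * s))) \<le> ?w s"
    proof (intro AE_I2)
      fix s :: real
      have "exp (- Y i * cosh s) * cosh (\<nu> * s) \<le> exp (- (z / 2) * cosh s) * cosh (\<nu> * s)"
        by (intro mult_right_mono) (auto simp: Y_def intro!: mult_right_mono)
      also have "\<dots> \<le> 8 / (z / 2)\<^sup>2 * exp (- s)" if "0 \<le> s"
        using z \<nu> that by (intro besselK_integrand_le) auto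
      finally show "norm (indicator {0..} s * (exp (- Y i * cosh s) * cosh (\<nu> * s))) \<le> ?w s"
        by (simp add: indicator_def)
    qed
  qed auto
  moreover have "\<forall>\<^sub>F i in sequentially. besselK \<nu> (Y i) = besselK \<nu> (X i)"
    using order_tendstoD(1)[OF X, of "z / 2"] z by (auto simp: Y_def elim: eventually_mono)
  ultimately show "(\<lambda>i. besselK \<nu> (X i)) \<longlonglongrightarrow> besselK \<nu> z"
    by (rule Lim_transform_eventually)
qed

text \<open>One summand of the spectral density with its singularity moved to the origin. At
  \<open>z = 0\<close> the divisor is \<open>0 powr _ = 0\<close>, so the value there is the default
  0.\<close>

definition besselK_kernel :: "real \<Rightarrow> real \<Rightarrow> real" where
  "besselK_kernel \<kappa> z = besselK ((\<kappa> - 1) / 2) \<bar>z\<bar> / \<bar>z\<bar> powr ((1 - \<kappa>) / 2)"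

lemma measurable_besselK_kernel [measurable]: "besselK_kernel \<kappa> \<in> borel_measurable borel"
  unfolding besselK_kernel_def[abs_def] by measurable

lemma besselK_kernel_nonneg: "0 \<le> besselK_kernel \<kappa> z"
  by (simp add: besselK_kernel_def besselK_nonneg)

lemma isCont_besselK_kernel:
  assumes "0 < \<kappa>" "\<kappa> < 1" "z \<noteq> 0"
  shows "isCont (besselK_kernel \<kappa>) z"
  unfolding besselK_kernel_def[abs_def] using assms
  by (intro continuous_intros isCont_o2[OF _ isCont_besselK]) auto

lemma nn_integral_powr_exp_abs_finite:
  fixes a :: real
  assumes "a < 1"
  shows "(\<integral>\<^sup>+z. ennreal (\<bar>z\<bar> powr (-a) * exp (- \<bar>z\<bar>)) \<partial>lborel) < \<infinity>"
proof -
  \<comment> \<open>The integrand of \<open>Gamma (1 - a)\<close>; one copy serves each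
    half-line.\<close>
  let ?g = "\<lambda>t. ennreal (indicator {0..} t * t powr ((1 - a) - 1) / exp t)"
  have g: "(\<integral>\<^sup>+t. ?g t \<partial>lborel) = Gamma (1 - a)"
    using Gamma_conv_nn_integral_real[of "1 - a"] assms by simp
  have "(\<integral>\<^sup>+t. ?g t \<partial>lborel) = (\<integral>\<^sup>+t. ?g (- t) \<partial>lborel)"
    using nn_integral_real_affine[of ?g "-1" 0] by simp
  then have "(\<integral>\<^sup>+t. ?g t + ?g (- t) \<partial>lborel) < \<infinity>"
    using g by (subst nn_integral_add) auto
  moreover have "(\<integral>\<^sup>+z. ennreal (\<bar>z\<bar> powr (-a) * exp (- \<bar>z\<bar>)) \<partial>lborel) \<le> (\<integral>\<^sup>+t. ?g t + ?g (- t) \<partial>lborel)"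
  proof (intro nn_integral_mono)
    fix z :: real
    show "ennreal (\<bar>z\<bar> powr (-a) * exp (- \<bar>z\<bar>)) \<le> ?g z + ?g (- z)"
      by (cases "z \<ge> 0"; cases "z = 0") (auto simp: exp_minus field_simps)
  qed
  ultimately show ?thesis by order
qed

lemma nn_integral_powr_exp_abs_scale:
  fixes a b :: real
  assumes "0 < b"
  shows "(\<integral>\<^sup>+z. ennreal (\<bar>z\<bar> powr (-a) * exp (- \<bar>z\<bar> * b)) \<partial>lborel) =
     ennreal (b powr (a - 1)) * (\<integral>\<^sup>+z. ennreal (\<bar>z\<bar> powr (-a) * exp (- \<bar>z\<bar>)) \<partial>lborel)"
proof -
  have "(\<integral>\<^sup>+z. ennreal (\<bar>z\<bar> powr (-a) * exp (- \<bar>z\<bar> * b)) \<partial>lborel) =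
      ennreal (1 / b) * (\<integral>\<^sup>+z. ennreal (b powr a) * ennreal (\<bar>z\<bar> powr (-a) * exp (- \<bar>z\<bar>)) \<partial>lborel)"
    using assms
    by (subst nn_integral_real_affine[where c="1 / b" and t=0])
       (auto simp: abs_mult powr_divide powr_minus_divide ennreal_mult[symmetric] field_simps intro!: nn_integral_cong)
  also have "\<dots> = ennreal (1 / b * b powr a) * (\<integral>\<^sup>+z. ennreal (\<bar>z\<bar> powr (-a) * exp (- \<bar>z\<bar>)) \<partial>lborel)"
    using assms ennreal_mult[of "1 / b" "b powr a"] by (subst nn_integral_cmult) (auto simp: mult.assoc)
  also have "1 / b * b powr a = b powr (a - 1)" using assms by (simp add: powr_diff)
  finally show ?thesis .
qed

text \<open>Tonelli with \<open>z\<close> integrated first. Scaling turns the inner integral into a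
  multiple of \<open>cosh s powr (a - 1)\<close>, and since \<open>\<bar>\<nu>\<bar> = a\<close> the
  remaining integrand is at most a constant times \<open>exp (a * s) * exp ((a - 1) * s)\<close>.
  The exponent \<open>2 * a - 1\<close> equals \<open>- \<kappa>\<close>, so positivity of \<kappa>
  is what makes it integrable.\<close>

lemma integrable_besselK_kernel:
  assumes \<kappa>: "0 < \<kappa>" "\<kappa> < 1"
  shows "integrable lborel (besselK_kernel \<kappa>)"
proof (rule integrableI_nonneg)
  define \<nu> a where "\<nu> = (\<kappa> - 1) / 2" and "a = (1 - \<kappa>) / 2"
  define J where "J = (\<integral>\<^sup>+z. ennreal (\<bar>z\<bar> powr (-a) * exp (- \<bar>z\<bar>)) \<partial>lborel)"
  have "a < 1" using \<kappa> by (simp add: a_def)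
  then have J: "J < \<infinity>"
    unfolding J_def by (rule nn_integral_powr_exp_abs_finite)
  let ?h = "\<lambda>z s. indicator {0..} s * (exp (- \<bar>z\<bar> * cosh s) * cosh (\<nu> * s)) :: real"
  have le: "ennreal (besselK_kernel \<kappa> z) \<le> (\<integral>\<^sup>+s. ennreal (\<bar>z\<bar> powr (-a) * ?h z s) \<partial>lborel)" for z
  proof -
    \<comment> \<open>Only an inequality is claimed: where the integral diverges, as at
      \<open>z = 0\<close>, the Bochner integral is 0 by default.\<close>
    have "ennreal (besselK \<nu> \<bar>z\<bar>) \<le> (\<integral>\<^sup>+s. ennreal (?h z s) \<partial>lborel)"
      unfolding besselK_eq by (subst integral_eq_nn_integral) (auto simp: ennreal_enn2real_if)
    then have "ennreal (\<bar>z\<bar> powr (-a)) * ennreal (besselK \<nu> \<bar>z\<bar>)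
        \<le> ennreal (\<bar>z\<bar> powr (-a)) * (\<integral>\<^sup>+s. ennreal (?h z s) \<partial>lborel)"
      by (rule mult_left_mono) simp
    then show ?thesis
      by (simp add: besselK_kernel_def \<nu>_def[symmetric] a_def[symmetric] powr_minus_divide
          nn_integral_cmult[symmetric] ennreal_mult[symmetric] besselK_nonneg)
  qed
  have "(\<integral>\<^sup>+z. ennreal (besselK_kernel \<kappa> z) \<partial>lborel)
      \<le> (\<integral>\<^sup>+z. (\<integral>\<^sup>+s. ennreal (\<bar>z\<bar> powr (-a) * ?h z s) \<partial>lborel) \<partial>lborel)"
    by (intro nn_integral_mono le)
  also have "\<dots> = (\<integral>\<^sup>+s. (\<integral>\<^sup>+z. ennreal (\<bar>z\<bar> powr (-a) * ?h z s) \<partial>lborel) \<partial>lborel)"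
    by (rule lborel_pair.Fubini'[symmetric]) measurable
  also have "\<dots> = (\<integral>\<^sup>+s. ennreal (indicator {0..} s * cosh (\<nu> * s)) *
      (\<integral>\<^sup>+z. ennreal (\<bar>z\<bar> powr (-a) * exp (- \<bar>z\<bar> * cosh s)) \<partial>lborel) \<partial>lborel)"
    by (subst nn_integral_cmult[symmetric])
       (auto simp: ennreal_mult[symmetric] ac_simps)
  also have "\<dots> = (\<integral>\<^sup>+s. ennreal (indicator {0..} s * cosh (\<nu> * s)) * (ennreal (cosh s powr (a - 1)) * J) \<partial>lborel)"
    by (subst nn_integral_powr_exp_abs_scale) (auto simp: J_def)
  also have "\<dots> \<le> (\<integral>\<^sup>+s. (ennreal (2 powr (1 - a)) * J) * ennreal (indicator {0..} s * exp (- (\<kappa> * s))) \<partial>lborel)"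
  proof (intro nn_integral_mono)
    fix s :: real
    show "ennreal (indicator {0..} s * cosh (\<nu> * s)) * (ennreal (cosh s powr (a - 1)) * J)
        \<le> (ennreal (2 powr (1 - a)) * J) * ennreal (indicator {0..} s * exp (- (\<kappa> * s)))"
    proof (cases "s \<ge> 0")
      case True
      have "cosh s powr (a - 1) \<le> (exp s / 2) powr (a - 1)"
        using \<open>a < 1\<close> by (intro powr_mono2' cosh_ge_half_exp) auto
      also have "\<dots> = 2 powr (1 - a) * exp ((a - 1) * s)"
        by (simp add: powr_divide exp_powr_real mult.commute powr_diff) (simp add: algebra_simps exp_diff)
      finally have "cosh (\<nu> * s) * cosh s powr (a - 1) \<le> exp (a * s) * (2 powr (1 - a) * exp ((a - 1) * s))"
        using \<kappa> True by (intro mult_mono cosh_mult_le_exp) (auto simp: \<nu>_def a_def)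
      also have "\<dots> = 2 powr (1 - a) * exp (- (\<kappa> * s))"
        by (simp add: exp_add[symmetric] a_def field_simps)
      finally have "ennreal (cosh (\<nu> * s) * cosh s powr (a - 1)) * J
          \<le> ennreal (2 powr (1 - a) * exp (- (\<kappa> * s))) * J"
        by (intro mult_right_mono ennreal_leI) auto
      then show ?thesis using True by (simp add: ennreal_mult ac_simps)
    qed simp
  qed
  also have "\<dots> = ennreal (2 powr (1 - a)) * J * ennreal (1 / \<kappa>)"
    using \<kappa> by (subst nn_integral_cmult) (auto simp: nn_integral_exp_Ici)
  also have "\<dots> < \<infinity>" using J by (simp add: ennreal_mult_less_top)
  finally show "(\<integral>\<^sup>+z. ennreal (besselK_kernel \<kappa> z) \<partial>lborel) < \<infinity>" .
qed (auto simp: besselK_kernel_nonneg)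

section \<open>The full spectral density: symmetry, integrability, behaviour at the origin\<close>

lemma specdens_eq:
  "specdens n A w \<kappa> l = (\<Sum>j=0..n. c1 (\<kappa> j) / 2 * A j *
      (besselK_kernel (\<kappa> j) (l + w j) + besselK_kernel (\<kappa> j) (l - w j)))"
  by (simp add: specdens_def besselK_kernel_def)

text \<open>Reflection exchanges the two mirror terms of each summand. This evenness is needed for
  the kernels of the field to be hermitian.\<close>

lemma specdens_minus: "specdens n A w \<kappa> (- l) = specdens n A w \<kappa> l"
proof -
  have "besselK_kernel k (- l + x) = besselK_kernel k (l - x)"
    "besselK_kernel k (- l - x) = besselK_kernel k (l + x)" for k x
    using abs_minus_cancel[of "l + x"]
    by (simp_all add: besselK_kernel_def abs_minus_commute add.commute)
  then show ?thesis by (simp add: specdens_eq add.commute)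
qed

lemma c1_nonneg: "0 < \<kappa> \<Longrightarrow> 0 \<le> c1 \<kappa>"
  by (simp add: c1_def Gamma_real_nonneg)

lemma specdens_nonneg:
  assumes "\<forall>j\<le>n. A j \<ge> 0" "\<forall>j\<le>n. 0 < \<kappa> j \<and> \<kappa> j < 1"
  shows "0 \<le> specdens n A w \<kappa> l"
  unfolding specdens_eq using assms
  by (intro sum_nonneg mult_nonneg_nonneg add_nonneg_nonneg divide_nonneg_nonneg besselK_kernel_nonneg c1_nonneg) auto

lemma constC_nonneg:
  assumes "\<forall>j\<le>n. A j \<ge> 0" "\<forall>j\<le>n. 0 < \<kappa> j \<and> \<kappa> j < 1"
  shows "0 \<le> constC n A w \<kappa>"
  unfolding constC_def using assms
  by (intro sum_nonneg mult_nonneg_nonneg besselK_nonneg c1_nonneg) auto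

lemma integrable_specdens:
  assumes "\<forall>j\<le>n. 0 < \<kappa> j \<and> \<kappa> j < 1"
  shows "integrable lborel (specdens n A w \<kappa>)"
  unfolding specdens_eq[abs_def]
proof (intro Bochner_Integration.integrable_sum integrable_mult_right Bochner_Integration.integrable_add)
  fix j assume "j \<in> {0..n}"
  then have i: "integrable lborel (besselK_kernel (\<kappa> j))" using assms by (intro integrable_besselK_kernel) auto
  show "integrable lborel (\<lambda>l. besselK_kernel (\<kappa> j) (l + w j))"
    using lborel_integrable_real_affine[OF i, of 1 "w j"] by (simp add: add.commute)
  show "integrable lborel (\<lambda>l. besselK_kernel (\<kappa> j) (l - w j))"
    using lborel_integrable_real_affine[OF i, of 1 "- w j"] by simp
qed

text \<open>At the origin the two mirror terms coincide, which absorbs the factor 1/2; the summand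
  \<open>j = 0\<close> disappears with \<open>A 0\<close>.\<close>

lemma specdens_0:
  assumes "A 0 = 0"
  shows "specdens n A w \<kappa> 0 = constC n A w \<kappa>"
proof -
  have "specdens n A w \<kappa> 0 = (\<Sum>j=0..n. c1 (\<kappa> j) * A j * besselK ((\<kappa> j - 1) / 2) \<bar>w j\<bar>
                                * \<bar>w j\<bar> powr ((\<kappa> j - 1) / 2))"
  proof (unfold specdens_def, intro sum.cong refl)
    fix j
    have "(\<kappa> j - 1) / 2 = - ((1 - \<kappa> j) / 2)" by (simp add: field_simps)
    then have *: "\<bar>w j\<bar> powr ((\<kappa> j - 1) / 2) = 1 / \<bar>w j\<bar> powr ((1 - \<kappa> j) / 2)"
      by (simp only: powr_minus_divide)
    show "c1 (\<kappa> j) / 2 * A j *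
      (besselK ((\<kappa> j - 1) / 2) \<bar>0 + w j\<bar> / \<bar>0 + w j\<bar> powr ((1 - \<kappa> j) / 2)
     + besselK ((\<kappa> j - 1) / 2) \<bar>0 - w j\<bar> / \<bar>0 - w j\<bar> powr ((1 - \<kappa> j) / 2)) =
      c1 (\<kappa> j) * A j * besselK ((\<kappa> j - 1) / 2) \<bar>w j\<bar> * \<bar>w j\<bar> powr ((\<kappa> j - 1) / 2)"
      unfolding * by simp
  qed
  then show ?thesis using assms by (simp add: constC_def sum.atLeast_Suc_atMost)
qed

lemma isCont_specdens_0:
  assumes "A 0 = 0" "\<forall>j. 1 \<le> j \<and> j \<le> n \<longrightarrow> w j \<noteq> 0" "\<forall>j\<le>n. 0 < \<kappa> j \<and> \<kappa> j < 1"
  shows "isCont (specdens n A w \<kappa>) 0"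
proof -
  have "isCont (\<lambda>l. c1 (\<kappa> j) / 2 * A j *
      (besselK_kernel (\<kappa> j) (l + w j) + besselK_kernel (\<kappa> j) (l - w j))) 0" if "j \<in> {0..n}" for j
  proof (cases "j = 0")
    case False
    then show ?thesis using assms that
      by (intro continuous_intros isCont_o2[OF _ isCont_besselK_kernel]) auto
  qed (use assms in simp)
  then show ?thesis unfolding specdens_eq[abs_def] by (intro isCont_sum) auto
qed

subsection \<open>Gaussian dilations of an integrable function\<close>

lemma integrable_gaussian:
  fixes c :: real
  assumes "0 < c"
  shows "integrable lborel (\<lambda>l. exp (- (c * l\<^sup>2)))"
proof -
  have "integrable lborel (\<lambda>l. sqrt (2 * pi * (sqrt (1 / (2 * c)))\<^sup>2) * normal_density 0 (sqrt (1 / (2 * c))) l)"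
    using assms by (intro integrable_mult_right integrable_normal_density) auto
  then show ?thesis using assms by (simp add: normal_density_def field_simps)
qed

text \<open>Where \<open>\<bar>s * l\<bar> < \<delta>\<close>, continuity at 0 makes
  \<open>f (s * l)\<close> close to \<open>f 0\<close>. Elsewhere only integrability of
  \<open>f\<close> is available: its dilation has mass \<open>N / s\<close>, but
  \<open>\<bar>l\<bar> \<ge> \<delta> / s\<close> there, and the Gaussian is then smaller than any
  power of \<open>s\<close>.\<close>

lemma tendsto_integral_gaussian_dilation:
  fixes f h :: "real \<Rightarrow> real"
  assumes f: "integrable lborel f" and cont: "isCont f 0"
    and h [measurable]: "h \<in> borel_measurable borel" and B: "\<And>l. \<bar>h l\<bar> \<le> B"
  shows "((\<lambda>s. \<integral>l. h l * exp (- l\<^sup>2 / 2) * f (s * l) \<partial>lborel)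
            \<longlongrightarrow> f 0 * (\<integral>l. h l * exp (- l\<^sup>2 / 2) \<partial>lborel)) (at_right 0)"
proof -
  note [measurable] = borel_measurable_integrable[OF f]
  define G2 G4 N where "G2 = (\<integral>l. exp (- (1/2 * (l::real)\<^sup>2)) \<partial>lborel)"
    and "G4 = (\<integral>l. exp (- (1/4 * (l::real)\<^sup>2)) \<partial>lborel)" and "N = (\<integral>l. \<bar>f l\<bar> \<partial>lborel)"
  have B0: "0 \<le> B" using B[of 0] by linarith
  have G: "integrable lborel (\<lambda>l::real. exp (- (1/2 * l\<^sup>2)))" "integrable lborel (\<lambda>l::real. exp (- (1/4 * l\<^sup>2)))"
    by (rule integrable_gaussian, simp)+
  have "G2 \<ge> 0" by (simp add: G2_def)
  have ih: "integrable lborel (\<lambda>l. h l * exp (- l\<^sup>2 / 2))"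
    by (rule Bochner_Integration.integrable_bound[OF integrable_mult_right[OF G(1), of B]])
       (use B B0 in \<open>auto simp: abs_mult intro!: mult_right_mono\<close>)
  show ?thesis
  proof (rule tendstoI)
    fix r :: real assume r: "0 < r"
    \<comment> \<open>Chosen so that the near part, at most \<open>B * (\<eta> * G2)\<close>, stays
      below \<open>r / 2\<close>; the added 1 keeps \<open>D\<close> positive even for
      \<open>B = 0\<close>.\<close>
    define D where "D = B * G2 + 1"
    define \<eta> where "\<eta> = r / (2 * D)"
    have den: "D > 0" using B0 \<open>G2 \<ge> 0\<close> by (simp add: D_def add_nonneg_pos)
    then have \<eta>: "\<eta> > 0" using r by (simp add: \<eta>_def)
    have "B * (\<eta> * G2) \<le> \<eta> * D" using \<eta> by (simp add: D_def algebra_simps)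
    also have "\<dots> = r / 2" using den by (simp add: \<eta>_def)
    finally have small: "B * (\<eta> * G2) \<le> r / 2" .
    obtain \<delta> where \<delta>: "\<delta> > 0" "\<And>x. \<bar>x\<bar> < \<delta> \<Longrightarrow> \<bar>f x - f 0\<bar> < \<eta>"
      using cont[unfolded continuous_at_eps_delta] \<eta> by (auto simp: dist_real_def)
    \<comment> \<open>The integrated bound for the far part: the first term belongs to
      \<open>f (s * l)\<close>, the second to the constant \<open>f 0\<close>.\<close>
    let ?E = "\<lambda>s::real. B * (exp (- (\<delta>\<^sup>2 / (2 * s\<^sup>2))) * (N / s) + \<bar>f 0\<bar> * (exp (- (\<delta>\<^sup>2 / (4 * s\<^sup>2))) * G4))"
    have lims: "((\<lambda>s. exp (- (\<delta>\<^sup>2 / (2 * s\<^sup>2))) / s) \<longlongrightarrow> 0) (at_right 0)"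
      "((\<lambda>s. exp (- (\<delta>\<^sup>2 / (4 * s\<^sup>2)))) \<longlongrightarrow> 0) (at_right 0)"
      using \<delta>(1) by real_asymp+
    have "((\<lambda>s. B * (exp (- (\<delta>\<^sup>2 / (2 * s\<^sup>2))) / s * N + \<bar>f 0\<bar> * (exp (- (\<delta>\<^sup>2 / (4 * s\<^sup>2))) * G4)))
        \<longlongrightarrow> B * (0 * N + \<bar>f 0\<bar> * (0 * G4))) (at_right 0)"
      by (intro tendsto_mult tendsto_add tendsto_const lims)
    then have "(?E \<longlongrightarrow> B * (0 * N + \<bar>f 0\<bar> * (0 * G4))) (at_right 0)" by simp
    then have "\<forall>\<^sub>F s in at_right 0. ?E s < r / 2"
      using r by (intro order_tendstoD(2)[of _ "B * (0 * N + \<bar>f 0\<bar> * (0 * G4))"]) auto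
    moreover have "\<forall>\<^sub>F s::real in at_right 0. 0 < s" by (simp add: eventually_at_right_less)
    ultimately show "\<forall>\<^sub>F s in at_right 0. dist (\<integral>l. h l * exp (- l\<^sup>2 / 2) * f (s * l) \<partial>lborel)
        (f 0 * (\<integral>l. h l * exp (- l\<^sup>2 / 2) \<partial>lborel)) < r"
    proof eventually_elim
      case (elim s)
      then have s: "s > 0" by simp
      have fs: "integrable lborel (\<lambda>l. f (s * l))"
        using lborel_integrable_real_affine[OF f, of s 0] s by simp
      have Ns: "(\<integral>l. \<bar>f (s * l)\<bar> \<partial>lborel) = N / s"
        using lborel_integral_real_affine[of s "\<lambda>l. \<bar>f l\<bar>" 0] s by (simp add: N_def)
      have ihf: "integrable lborel (\<lambda>l. h l * exp (- l\<^sup>2 / 2) * f (s * l))"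
      proof (rule Bochner_Integration.integrable_bound[OF integrable_mult_right[OF fs, of B]])
        have "\<bar>h l * exp (- l\<^sup>2 / 2)\<bar> \<le> B * 1" for l
          unfolding abs_mult using B[of l] by (intro mult_mono) auto
        then show "AE l in lborel. norm (h l * exp (- l\<^sup>2 / 2) * f (s * l)) \<le> norm (B * f (s * l))"
          using B0 by (intro AE_I2) (simp add: abs_mult mult_right_mono)
      qed simp
      let ?b = "\<lambda>l. B * (\<eta> * exp (- (1/2 * l\<^sup>2)) + (exp (- (\<delta>\<^sup>2 / (2 * s\<^sup>2))) * \<bar>f (s * l)\<bar>
          + \<bar>f 0\<bar> * (exp (- (\<delta>\<^sup>2 / (4 * s\<^sup>2))) * exp (- (1/4 * l\<^sup>2)))))"
      have pw: "\<bar>h l * exp (- l\<^sup>2 / 2) * f (s * l) - f 0 * (h l * exp (- l\<^sup>2 / 2))\<bar> \<le> ?b l" for l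
      proof -
        have "exp (- l\<^sup>2 / 2) * \<bar>f (s * l) - f 0\<bar> \<le> \<eta> * exp (- (1/2 * l\<^sup>2)) + (exp (- (\<delta>\<^sup>2 / (2 * s\<^sup>2))) * \<bar>f (s * l)\<bar>
          + \<bar>f 0\<bar> * (exp (- (\<delta>\<^sup>2 / (4 * s\<^sup>2))) * exp (- (1/4 * l\<^sup>2))))" (is "_ \<le> ?u + (?v + ?w)")
        proof (cases "\<bar>s * l\<bar> < \<delta>")
          case True
          then have "exp (- l\<^sup>2 / 2) * \<bar>f (s * l) - f 0\<bar> \<le> exp (- l\<^sup>2 / 2) * \<eta>"
            using \<delta>(2) by (intro mult_left_mono) (auto simp: less_imp_le)
          also have "\<dots> = ?u" by simp
          finally show ?thesis by (smt (verit) abs_ge_zero exp_ge_zero mult_nonneg_nonneg)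
        next
          case False
          then have "\<delta>\<^sup>2 \<le> (s * l)\<^sup>2" using \<delta>(1) by (metis abs_le_square_iff abs_of_pos not_less)
          then have dl: "\<delta>\<^sup>2 / s\<^sup>2 \<le> l\<^sup>2" using s by (simp add: field_simps power_mult_distrib)
          have "exp (- l\<^sup>2 / 2) * \<bar>f (s * l) - f 0\<bar> \<le> exp (- l\<^sup>2 / 2) * (\<bar>f (s * l)\<bar> + \<bar>f 0\<bar>)"
            by (intro mult_left_mono) auto
          also have "\<dots> = exp (- l\<^sup>2 / 2) * \<bar>f (s * l)\<bar> + \<bar>f 0\<bar> * exp (- l\<^sup>2 / 2)" by (simp add: algebra_simps)
          \<comment> \<open>Against the integrable \<open>f (s * l)\<close> the whole Gaussian can
            be spent on smallness. Against the constant \<open>f 0\<close> only half of the exponent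
            is spent, and \<open>exp (- (1/4 * l\<^sup>2))\<close> is kept to remain
            integrable.\<close>
          also have "\<dots> \<le> ?v + ?w"
            unfolding exp_add[symmetric] using dl
            by (intro add_mono mult_left_mono mult_right_mono) auto
          also have "\<dots> \<le> ?u + (?v + ?w)" using \<eta> by simp
          finally show ?thesis .
        qed
        then have "\<bar>h l\<bar> * (exp (- l\<^sup>2 / 2) * \<bar>f (s * l) - f 0\<bar>) \<le> ?b l"
          using B[of l] B0 by (intro mult_mono) auto
        moreover have "h l * exp (- l\<^sup>2 / 2) * f (s * l) - f 0 * (h l * exp (- l\<^sup>2 / 2))
            = h l * (exp (- l\<^sup>2 / 2) * (f (s * l) - f 0))" by (simp add: algebra_simps)
        ultimately show ?thesis by (simp add: abs_mult)
      qed
      have ib: "integrable lborel ?b"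
        using G fs by (intro integrable_mult_right Bochner_Integration.integrable_add integrable_abs)
      have "\<bar>(\<integral>l. h l * exp (- l\<^sup>2 / 2) * f (s * l) \<partial>lborel) - f 0 * (\<integral>l. h l * exp (- l\<^sup>2 / 2) \<partial>lborel)\<bar>
          = \<bar>\<integral>l. h l * exp (- l\<^sup>2 / 2) * f (s * l) - f 0 * (h l * exp (- l\<^sup>2 / 2)) \<partial>lborel\<bar>"
        using ihf ih by (subst Bochner_Integration.integral_diff) auto
      also have "\<dots> \<le> (\<integral>l. \<bar>h l * exp (- l\<^sup>2 / 2) * f (s * l) - f 0 * (h l * exp (- l\<^sup>2 / 2))\<bar> \<partial>lborel)"
        by (rule integral_abs_bound)
      also have "\<dots> \<le> (\<integral>l. ?b l \<partial>lborel)"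
        by (rule integral_mono[OF _ ib pw]) (intro integrable_abs Bochner_Integration.integrable_diff integrable_mult_right ihf ih)
      also have "\<dots> = B * (\<eta> * G2) + ?E s"
        using G fs by (simp add: Ns G2_def G4_def distrib_left)
      also have "\<dots> < r" using elim(1) small by linarith
      finally show ?case by (simp only: dist_real_def)
    qed
  qed
qed

subsection \<open>White-noise integrals\<close>

text \<open>The kernels fixed by the involution that the symmetric noise turns into complex
  conjugation; their noise integrals are almost surely real.\<close>

definition hermitian :: "(real \<Rightarrow> complex) \<Rightarrow> bool" where
  "hermitian \<phi> \<longleftrightarrow> (\<forall>l. cnj (\<phi> (- l)) = \<phi> l)"

lemma measurable_cnj [measurable]: "cnj \<in> borel_measurable borel"
  by (intro borel_measurable_continuous_onI continuous_intros)

lemma sq_integrableI_bound: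
  assumes "\<phi> \<in> borel_measurable borel" "integrable lborel g" "\<And>l. (cmod (\<phi> l))\<^sup>2 \<le> g l"
  shows "sq_integrable \<phi>"
  unfolding sq_integrable_def
proof
  show "integrable lborel (\<lambda>l. (cmod (\<phi> l))\<^sup>2)"
    using assms(1) by (intro Bochner_Integration.integrable_bound[OF assms(2)] AE_I2)
      (use assms(3) in \<open>auto intro: order_trans[OF _ abs_ge_self]\<close>)
qed fact

lemma sq_integrable_mult_const:
  assumes "sq_integrable \<phi>"
  shows "sq_integrable (\<lambda>l. c * \<phi> l)"
  using assms by (auto simp: sq_integrable_def norm_mult power_mult_distrib)

lemma norm_add_squared_le: "(norm (x + y))\<^sup>2 \<le> 2 * (norm x)\<^sup>2 + 2 * (norm (y :: 'a::real_normed_vector))\<^sup>2"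
proof -
  have "(norm (x + y))\<^sup>2 \<le> (norm x + norm y)\<^sup>2" by (intro power_mono norm_triangle_ineq) auto
  also have "\<dots> \<le> 2 * (norm x)\<^sup>2 + 2 * (norm y)\<^sup>2"
    using sum_squares_bound[of "norm x" "norm y"] by (simp add: power2_sum)
  finally show ?thesis .
qed

lemma sq_integrable_add:
  assumes "sq_integrable \<phi>" "sq_integrable \<psi>"
  shows "sq_integrable (\<lambda>l. \<phi> l + \<psi> l)"
  using assms
  by (intro sq_integrableI_bound[where g="\<lambda>l. 2 * (cmod (\<phi> l))\<^sup>2 + 2 * (cmod (\<psi> l))\<^sup>2"] norm_add_squared_le)
     (auto simp: sq_integrable_def)

lemma sq_integrable_zero: "sq_integrable (\<lambda>l. 0)"
  by (simp add: sq_integrable_def)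

lemma sq_integrable_sum:
  "(\<And>i. i \<in> S \<Longrightarrow> sq_integrable (\<phi> i)) \<Longrightarrow> sq_integrable (\<lambda>l. \<Sum>i\<in>S. \<phi> i l)"
  by (induction S rule: infinite_finite_induct) (auto intro: sq_integrable_add sq_integrable_zero)

lemma integrable_mult_of_squares:
  fixes f g :: "'a \<Rightarrow> 'b::{real_normed_div_algebra, banach, second_countable_topology}"
  assumes [measurable]: "f \<in> borel_measurable M" "g \<in> borel_measurable M"
    and "integrable M (\<lambda>x. (norm (f x))\<^sup>2)" "integrable M (\<lambda>x. (norm (g x))\<^sup>2)"
  shows "integrable M (\<lambda>x. f x * g x)"
proof (rule Bochner_Integration.integrable_bound)
  show "integrable M (\<lambda>x. (norm (f x))\<^sup>2 + (norm (g x))\<^sup>2)" using assms by simp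
  have "norm (f x * g x) \<le> (norm (f x))\<^sup>2 + (norm (g x))\<^sup>2" for x
    using sum_squares_bound[of "norm (f x)" "norm (g x)"]
      mult_nonneg_nonneg[OF norm_ge_zero norm_ge_zero, of "f x" "g x"] unfolding norm_mult by linarith
  then show "AE x in M. norm (f x * g x) \<le> norm ((norm (f x))\<^sup>2 + (norm (g x))\<^sup>2)" by simp
qed measurable

section \<open>Centred real Gaussian variables\<close>

lemma gaussian_integral_cos:
  assumes "0 < \<sigma>"
  shows "(\<integral>x. cos (x + b) \<partial>density lborel (normal_density 0 \<sigma>)) = cos b * exp (- \<sigma>\<^sup>2 / 2)"
proof -
  interpret N: real_distribution std_normal_distribution by (rule real_dist_normal_dist)
  have "char std_normal_distribution \<sigma> = complex_of_real (exp (- \<sigma>\<^sup>2 / 2))"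
    by (simp add: char_std_normal_distribution)
  then have ch: "(\<integral>x. iexp (\<sigma> * x) \<partial>std_normal_distribution) = complex_of_real (exp (- \<sigma>\<^sup>2 / 2))"
    by (simp add: char_def)
  have int: "integrable std_normal_distribution (\<lambda>x. iexp (\<sigma> * x))"
    by (rule N.integrable_const_bound[of _ 1]) auto
  have C: "(\<integral>x. cos (\<sigma> * x) \<partial>std_normal_distribution) = exp (- \<sigma>\<^sup>2 / 2)"
    using integral_Re[OF int] unfolding ch by (simp add: Re_exp)
  have S: "(\<integral>x. sin (\<sigma> * x) \<partial>std_normal_distribution) = 0"
    using integral_Im[OF int] unfolding ch by (simp add: Im_exp)
  have "(\<integral>x. cos (x + b) \<partial>density lborel (normal_density 0 \<sigma>)) =
      (\<integral>x. normal_density 0 \<sigma> x * cos (x + b) \<partial>lborel)"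
    by (subst integral_density) auto
  also have "\<dots> = (\<integral>x. std_normal_density x * cos (\<sigma> * x + b) \<partial>lborel)"
  proof -
    have "\<sigma> * normal_density 0 \<sigma> (\<sigma> * x) = std_normal_density x" for x
      using assms by (simp add: normal_density_def power_mult_distrib real_sqrt_mult)
    then show ?thesis
      using assms
      by (subst lborel_integral_real_affine[where c=\<sigma> and t=0])
         (simp_all add: mult.assoc[symmetric] del: integral_mult_right_zero flip: integral_mult_right_zero)
  qed
  also have "\<dots> = (\<integral>x. cos (\<sigma> * x + b) \<partial>std_normal_distribution)"
    by (subst integral_density) auto
  also have "\<dots> = (\<integral>x. cos b * cos (\<sigma> * x) - sin b * sin (\<sigma> * x) \<partial>std_normal_distribution)"
    by (simp add: cos_add mult.commute)
  also have "\<dots> = cos b * exp (- \<sigma>\<^sup>2 / 2)"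
  proof -
    have "integrable std_normal_distribution (\<lambda>x. cos (\<sigma> * x))"
      "integrable std_normal_distribution (\<lambda>x. sin (\<sigma> * x))"
      by (rule N.integrable_const_bound[of _ 1]; auto)+
    then show ?thesis by (simp add: C S)
  qed
  finally show ?thesis .
qed

text \<open>The unspecified \<sigma> of the definition is eliminated in favour of the second moment,
  which the isometry computes for noise integrals. The degenerate law is covered by the same
  formula.\<close>

lemma (in prob_space) real_gaussian_rv_facts:
  assumes "real_gaussian_rv M X"
  shows "expectation X = 0"
    and "expectation (\<lambda>\<omega>. cos (X \<omega> + b)) = cos b * exp (- expectation (\<lambda>\<omega>. (X \<omega>)\<^sup>2) / 2)"
proof -
  from assms have [measurable]: "X \<in> borel_measurable M" by (simp add: real_gaussian_rv_def)
  from assms obtain \<sigma> where \<sigma>: "\<sigma> \<ge> 0"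
    and d: "distr M borel X = (if \<sigma> = 0 then return borel 0 else density lborel (normal_density 0 \<sigma>))"
    by (auto simp: real_gaussian_rv_def)
  have E: "expectation (\<lambda>\<omega>. g (X \<omega>)) = (\<integral>x. g x \<partial>distr M borel X)"
    if "g \<in> borel_measurable borel" for g :: "real \<Rightarrow> real"
    using that by (subst integral_distr) auto
  have "expectation X = 0 \<and> expectation (\<lambda>\<omega>. (X \<omega>)\<^sup>2) = \<sigma>\<^sup>2 \<and>
      expectation (\<lambda>\<omega>. cos (X \<omega> + b)) = cos b * exp (- \<sigma>\<^sup>2 / 2)"
  proof (cases "\<sigma> = 0")
    case True
    then show ?thesis
      using E[of "\<lambda>x. x"] E[of "\<lambda>x. x\<^sup>2"] E[of "\<lambda>x. cos (x + b)"] d by (simp add: integral_return)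
  next
    case False
    then have s: "0 < \<sigma>" using \<sigma> by simp
    have "(\<integral>x. x \<partial>density lborel (normal_density 0 \<sigma>)) = 0"
      using integral_normal_moment_nz_1[OF s, of 0] by (subst integral_density) auto
    moreover have "(\<integral>x. x\<^sup>2 \<partial>density lborel (normal_density 0 \<sigma>)) = \<sigma>\<^sup>2"
      using integral_normal_moment_even[OF s, of 0 1] by (subst integral_density) (auto simp: fact_numeral)
    ultimately show ?thesis
      using E[of "\<lambda>x. x"] E[of "\<lambda>x. x\<^sup>2"] E[of "\<lambda>x. cos (x + b)"] d False gaussian_integral_cos[OF s]
      by simp
  qed
  then show "expectation X = 0"
    "expectation (\<lambda>\<omega>. cos (X \<omega> + b)) = cos b * exp (- expectation (\<lambda>\<omega>. (X \<omega>)\<^sup>2) / 2)" by auto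
qed

section \<open>Calculus of noise integrals\<close>

locale white_noise = prob_space M for M :: "'w measure" +
  fixes I :: "(real \<Rightarrow> complex) \<Rightarrow> 'w \<Rightarrow> complex"
  assumes noise: "complex_white_noise_integral M I"
begin

lemma
  assumes "sq_integrable \<phi>"
  shows measurable_noise: "I \<phi> \<in> borel_measurable M"
    and integrable_noise_sq: "integrable M (\<lambda>\<omega>. (cmod (I \<phi> \<omega>))\<^sup>2)"
    and gaussian_noise: "real_gaussian_rv M (\<lambda>\<omega>. Re (I \<phi> \<omega>))"
    and noise_cnj: "AE \<omega> in M. I (\<lambda>l. cnj (\<phi> (- l))) \<omega> = cnj (I \<phi> \<omega>)"
  using noise assms unfolding complex_white_noise_integral_def by blast+

lemma noise_linear:
  assumes "sq_integrable \<phi>" "sq_integrable \<psi>"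
  shows "AE \<omega> in M. I (\<lambda>l. a * \<phi> l + b * \<psi> l) \<omega> = a * I \<phi> \<omega> + b * I \<psi> \<omega>"
  using noise assms unfolding complex_white_noise_integral_def by blast

lemma noise_isometry:
  assumes "sq_integrable \<phi>" "sq_integrable \<psi>"
  shows "(\<integral>\<omega>. I \<phi> \<omega> * cnj (I \<psi> \<omega>) \<partial>M) = (\<integral>l. \<phi> l * cnj (\<psi> l) \<partial>lborel)"
  using noise assms unfolding complex_white_noise_integral_def by blast

lemma noise_hermitian_real:
  assumes "sq_integrable \<phi>" "hermitian \<phi>"
  shows "AE \<omega> in M. I \<phi> \<omega> = complex_of_real (Re (I \<phi> \<omega>))"
proof -
  have "(\<lambda>l. cnj (\<phi> (- l))) = \<phi>" using assms(2) by (auto simp: hermitian_def)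
  with noise_cnj[OF assms(1)] have "AE \<omega> in M. I \<phi> \<omega> = cnj (I \<phi> \<omega>)" by simp
  then show ?thesis by eventually_elim (simp add: complex_eq_iff)
qed

lemma noise_sum:
  assumes "finite S" "\<And>i. i \<in> S \<Longrightarrow> sq_integrable (\<phi> i)"
  shows "AE \<omega> in M. I (\<lambda>l. \<Sum>i\<in>S. c i * \<phi> i l) \<omega> = (\<Sum>i\<in>S. c i * I (\<phi> i) \<omega>)"
  using assms
proof (induction S rule: finite_induct)
  case empty
  show ?case using noise_linear[OF sq_integrable_zero sq_integrable_zero, of 0 0] by simp
next
  case (insert j S)
  have "sq_integrable (\<lambda>l. \<Sum>i\<in>S. c i * \<phi> i l)"
    using insert by (intro sq_integrable_sum sq_integrable_mult_const) auto
  from noise_linear[OF _ this, of "\<phi> j" "c j" 1] insert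
  have "AE \<omega> in M. I (\<lambda>l. c j * \<phi> j l + (\<Sum>i\<in>S. c i * \<phi> i l)) \<omega> =
      c j * I (\<phi> j) \<omega> + I (\<lambda>l. \<Sum>i\<in>S. c i * \<phi> i l) \<omega>" by simp
  moreover have "AE \<omega> in M. I (\<lambda>l. \<Sum>i\<in>S. c i * \<phi> i l) \<omega> = (\<Sum>i\<in>S. c i * I (\<phi> i) \<omega>)"
    using insert by auto
  ultimately show ?case unfolding sum.insert[OF insert(1,2)] by eventually_elim simp
qed

lemma noise_scale:
  assumes "sq_integrable \<phi>"
  shows "AE \<omega> in M. I (\<lambda>l. c * \<phi> l) \<omega> = c * I \<phi> \<omega>"
  using noise_linear[OF assms sq_integrable_zero, of c 0] by simp

lemma integrable_Re_noise_sq: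
  assumes "sq_integrable \<phi>"
  shows "integrable M (\<lambda>\<omega>. (Re (I \<phi> \<omega>))\<^sup>2)"
proof (rule Bochner_Integration.integrable_bound[OF integrable_noise_sq[OF assms]])
  show "(\<lambda>\<omega>. (Re (I \<phi> \<omega>))\<^sup>2) \<in> borel_measurable M" using measurable_noise[OF assms] by measurable
  have "(Re z)\<^sup>2 \<le> (cmod z)\<^sup>2" for z by (simp add: cmod_power2)
  then show "AE \<omega> in M. norm ((Re (I \<phi> \<omega>))\<^sup>2) \<le> norm ((cmod (I \<phi> \<omega>))\<^sup>2)" by simp
qed

text \<open>For hermitian kernels the integrals are almost surely real, so the complex isometry is
  already a statement about real parts.\<close>

lemma noise_covariance:
  assumes "sq_integrable \<phi>" "hermitian \<phi>" "sq_integrable \<psi>" "hermitian \<psi>"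
  shows "expectation (\<lambda>\<omega>. Re (I \<phi> \<omega>) * Re (I \<psi> \<omega>)) = Re (\<integral>l. \<phi> l * cnj (\<psi> l) \<partial>lborel)"
proof -
  note [measurable] = measurable_noise[OF assms(1)] measurable_noise[OF assms(3)]
  have "(\<integral>\<omega>. I \<phi> \<omega> * cnj (I \<psi> \<omega>) \<partial>M) = (\<integral>\<omega>. complex_of_real (Re (I \<phi> \<omega>) * Re (I \<psi> \<omega>)) \<partial>M)"
  proof (rule integral_cong_AE)
    show "AE \<omega> in M. I \<phi> \<omega> * cnj (I \<psi> \<omega>) = complex_of_real (Re (I \<phi> \<omega>) * Re (I \<psi> \<omega>))"
      using noise_hermitian_real[OF assms(1,2)] noise_hermitian_real[OF assms(3,4)]
      by eventually_elim (metis complex_cnj_complex_of_real of_real_mult)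
  qed measurable
  then show ?thesis
    using noise_isometry[OF assms(1,3)] by (metis Re_complex_of_real integral_complex_of_real)
qed

lemma noise_variance:
  assumes "sq_integrable \<phi>" "hermitian \<phi>"
  shows "expectation (\<lambda>\<omega>. (Re (I \<phi> \<omega>))\<^sup>2) = (\<integral>l. (cmod (\<phi> l))\<^sup>2 \<partial>lborel)"
  using noise_covariance[OF assms assms]
  unfolding complex_norm_square[symmetric] integral_complex_of_real power2_eq_square[of "Re _"] by simp

lemma noise_mean: "sq_integrable \<phi> \<Longrightarrow> expectation (\<lambda>\<omega>. Re (I \<phi> \<omega>)) = 0"
  by (rule real_gaussian_rv_facts(1)[OF gaussian_noise])

lemma noise_cos:
  assumes "sq_integrable \<phi>" "hermitian \<phi>"
  shows "expectation (\<lambda>\<omega>. cos (Re (I \<phi> \<omega>) + b)) = cos b * exp (- (\<integral>l. (cmod (\<phi> l))\<^sup>2 \<partial>lborel) / 2)"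
  using real_gaussian_rv_facts(2)[OF gaussian_noise[OF assms(1)], of b] noise_variance[OF assms] by simp

section \<open>Exchanging a weighted pathwise integral with the noise\<close>

text \<open>The bound \<open>\<bar>V y \<omega> * \<zeta> \<omega>\<bar> \<le> (V y
  \<omega>)\<^sup>2 + (\<zeta> \<omega>)\<^sup>2\<close> has an expectation bounded uniformly in
  \<open>y\<close>, which is all that Fubini asks for beyond integrability of \<open>e\<close>. The
  choice \<open>\<zeta> = 1\<close> gives integrability of the weighted field itself.\<close>

lemma integrable_weighted_product:
  fixes e :: "real \<Rightarrow> real" and V :: "real \<Rightarrow> 'w \<Rightarrow> real" and \<zeta> :: "'w \<Rightarrow> real"
  assumes e: "integrable lborel e"
    and V [measurable]: "(\<lambda>(y, \<omega>). V y \<omega>) \<in> borel_measurable (lborel \<Otimes>\<^sub>M M)"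
    and V2: "\<And>y. integrable M (\<lambda>\<omega>. (V y \<omega>)\<^sup>2)" "\<And>y. expectation (\<lambda>\<omega>. (V y \<omega>)\<^sup>2) \<le> K"
    and \<zeta> [measurable]: "\<zeta> \<in> borel_measurable M" and \<zeta>2: "integrable M (\<lambda>\<omega>. (\<zeta> \<omega>)\<^sup>2)"
  shows "integrable (lborel \<Otimes>\<^sub>M M) (\<lambda>(y, \<omega>). e y * (V y \<omega> * \<zeta> \<omega>))"
proof -
  interpret pair_sigma_finite lborel M ..
  note [measurable] = borel_measurable_integrable[OF e]
  have [measurable]: "V y \<in> borel_measurable M" for y
    using measurable_compose_Pair1[OF _ V, of y] by simp
  have i: "integrable M (\<lambda>\<omega>. V y \<omega> * \<zeta> \<omega>)" for y
    using V2(1)[of y] \<zeta>2 by (intro integrable_mult_of_squares) auto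
  have le: "expectation (\<lambda>\<omega>. \<bar>V y \<omega> * \<zeta> \<omega>\<bar>) \<le> K + expectation (\<lambda>\<omega>. (\<zeta> \<omega>)\<^sup>2)" for y
  proof -
    have "expectation (\<lambda>\<omega>. \<bar>V y \<omega> * \<zeta> \<omega>\<bar>) \<le> expectation (\<lambda>\<omega>. (V y \<omega>)\<^sup>2 + (\<zeta> \<omega>)\<^sup>2)"
    proof (intro integral_mono integrable_abs i Bochner_Integration.integrable_add V2(1) \<zeta>2)
      fix \<omega>
      show "\<bar>V y \<omega> * \<zeta> \<omega>\<bar> \<le> (V y \<omega>)\<^sup>2 + (\<zeta> \<omega>)\<^sup>2"
        using sum_squares_bound[of "\<bar>V y \<omega>\<bar>" "\<bar>\<zeta> \<omega>\<bar>"] abs_ge_zero[of "V y \<omega> * \<zeta> \<omega>"]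
        unfolding abs_mult power2_abs by linarith
    qed
    also have "\<dots> \<le> K + expectation (\<lambda>\<omega>. (\<zeta> \<omega>)\<^sup>2)" using V2 \<zeta>2 by simp
    finally show ?thesis .
  qed
  show ?thesis
  proof (rule Fubini_integrable)
    show "AE y in lborel. integrable M (\<lambda>\<omega>. case (y, \<omega>) of (y, \<omega>) \<Rightarrow> e y * (V y \<omega> * \<zeta> \<omega>))"
      using i by (intro AE_I2) simp
    show "integrable lborel (\<lambda>y. \<integral>\<omega>. norm (case (y, \<omega>) of (y, \<omega>) \<Rightarrow> e y * (V y \<omega> * \<zeta> \<omega>)) \<partial>M)"
    proof (rule Bochner_Integration.integrable_bound)
      show "integrable lborel (\<lambda>y. (K + expectation (\<lambda>\<omega>. (\<zeta> \<omega>)\<^sup>2)) * \<bar>e y\<bar>)" using e by simp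
      show "AE y in lborel. norm (\<integral>\<omega>. norm (case (y, \<omega>) of (y, \<omega>) \<Rightarrow> e y * (V y \<omega> * \<zeta> \<omega>)) \<partial>M)
          \<le> norm ((K + expectation (\<lambda>\<omega>. (\<zeta> \<omega>)\<^sup>2)) * \<bar>e y\<bar>)"
      proof (intro AE_I2)
        fix y
        have "norm (\<integral>\<omega>. norm (case (y, \<omega>) of (y, \<omega>) \<Rightarrow> e y * (V y \<omega> * \<zeta> \<omega>)) \<partial>M)
            = \<bar>e y\<bar> * expectation (\<lambda>\<omega>. \<bar>V y \<omega> * \<zeta> \<omega>\<bar>)"
          by (simp add: abs_mult[of "e y"] abs_mult[of "\<bar>e y\<bar>"])
        also have "\<dots> \<le> \<bar>e y\<bar> * (K + expectation (\<lambda>\<omega>. (\<zeta> \<omega>)\<^sup>2))" by (intro mult_left_mono le) simp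
        also have "\<dots> \<le> norm ((K + expectation (\<lambda>\<omega>. (\<zeta> \<omega>)\<^sup>2)) * \<bar>e y\<bar>)" by (simp add: mult.commute)
        finally show "norm (\<integral>\<omega>. norm (case (y, \<omega>) of (y, \<omega>) \<Rightarrow> e y * (V y \<omega> * \<zeta> \<omega>)) \<partial>M)
          \<le> norm ((K + expectation (\<lambda>\<omega>. (\<zeta> \<omega>)\<^sup>2)) * \<bar>e y\<bar>)" .
      qed
    qed measurable
  qed measurable
qed

text \<open>Weighted Cauchy-Schwarz: the squared integral is at most the total weight times the
  integral of the weighted square, and the latter is integrable over the sample space by
  Fubini.\<close>

lemma integrable_square_weighted_integral:
  fixes e :: "real \<Rightarrow> real" and V :: "real \<Rightarrow> 'w \<Rightarrow> real"
  assumes e: "integrable lborel e" "\<And>y. 0 < e y"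
    and V [measurable]: "(\<lambda>(y, \<omega>). V y \<omega>) \<in> borel_measurable (lborel \<Otimes>\<^sub>M M)"
    and V2: "\<And>y. integrable M (\<lambda>\<omega>. (V y \<omega>)\<^sup>2)" "\<And>y. expectation (\<lambda>\<omega>. (V y \<omega>)\<^sup>2) \<le> K"
  shows "integrable M (\<lambda>\<omega>. (\<integral>y. e y * V y \<omega> \<partial>lborel)\<^sup>2)"
proof -
  interpret pair_sigma_finite lborel M ..
  note [measurable] = borel_measurable_integrable[OF e(1)]
  have [measurable]: "V y \<in> borel_measurable M" for y
    using measurable_compose_Pair1[OF _ V, of y] by simp
  define E where "E = (\<integral>y. e y \<partial>lborel)"
  have "E \<ge> 0" unfolding E_def using e(2) by (intro Bochner_Integration.integral_nonneg) (auto simp: less_imp_le)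
  have i1: "integrable (lborel \<Otimes>\<^sub>M M) (\<lambda>(y, \<omega>). e y * V y \<omega>)"
    using integrable_weighted_product[OF e(1) V V2, of "\<lambda>_. 1"] by simp
  have i2: "integrable (lborel \<Otimes>\<^sub>M M) (\<lambda>(y, \<omega>). e y * (V y \<omega>)\<^sup>2)"
  proof (rule Fubini_integrable)
    show "integrable lborel (\<lambda>y. \<integral>\<omega>. norm (case (y, \<omega>) of (y, \<omega>) \<Rightarrow> e y * (V y \<omega>)\<^sup>2) \<partial>M)"
    proof (rule Bochner_Integration.integrable_bound)
      show "integrable lborel (\<lambda>y. K * e y)" using e by simp
      show "AE y in lborel. norm (\<integral>\<omega>. norm (case (y, \<omega>) of (y, \<omega>) \<Rightarrow> e y * (V y \<omega>)\<^sup>2) \<partial>M) \<le> norm (K * e y)"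
      proof (intro AE_I2)
        fix y
        have "\<bar>e y\<bar> * expectation (\<lambda>\<omega>. (V y \<omega>)\<^sup>2) \<le> \<bar>e y\<bar> * \<bar>K\<bar>"
          using V2(2)[of y] by (intro mult_left_mono) auto
        then show "norm (\<integral>\<omega>. norm (case (y, \<omega>) of (y, \<omega>) \<Rightarrow> e y * (V y \<omega>)\<^sup>2) \<partial>M) \<le> norm (K * e y)"
          by (simp add: abs_mult mult.commute)
      qed
    qed measurable
    show "AE y in lborel. integrable M (\<lambda>\<omega>. case (y, \<omega>) of (y, \<omega>) \<Rightarrow> e y * (V y \<omega>)\<^sup>2)"
      using V2 by (intro AE_I2) simp
  qed measurable
  show ?thesis
  proof (rule Bochner_Integration.integrable_bound)
    show "integrable M (\<lambda>\<omega>. E * (\<integral>y. e y * (V y \<omega>)\<^sup>2 \<partial>lborel))"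
      by (intro integrable_mult_right integrable_snd i2)
    show "AE \<omega> in M. norm ((\<integral>y. e y * V y \<omega> \<partial>lborel)\<^sup>2) \<le> norm (E * (\<integral>y. e y * (V y \<omega>)\<^sup>2 \<partial>lborel))"
      using AE_integrable_snd[OF i1] AE_integrable_snd[OF i2]
    proof eventually_elim
      case (elim \<omega>)
      define A B where "A = (\<integral>y. e y * V y \<omega> \<partial>lborel)" and "B = (\<integral>y. e y * (V y \<omega>)\<^sup>2 \<partial>lborel)"
      \<comment> \<open>The right-hand side is \<open>E * (E * B - A\<^sup>2)\<close>, the weighted
        integral of a square.\<close>
      have "0 \<le> E\<^sup>2 * B - 2 * (E * A) * A + A\<^sup>2 * E"
      proof -
        have "0 \<le> (\<integral>y. e y * (E * V y \<omega> - A)\<^sup>2 \<partial>lborel)"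
          using e(2) by (intro Bochner_Integration.integral_nonneg) (auto simp: less_imp_le)
        also have "\<dots> = (\<integral>y. (E\<^sup>2 * (e y * (V y \<omega>)\<^sup>2) - 2 * E * A * (e y * V y \<omega>)) + A\<^sup>2 * e y \<partial>lborel)"
          by (intro Bochner_Integration.integral_cong) (auto simp: power2_eq_square algebra_simps)
        also have "\<dots> = E\<^sup>2 * B - 2 * (E * A) * A + A\<^sup>2 * E"
          using elim e by (simp add: A_def B_def E_def)
        finally show ?thesis .
      qed
      then have "E * A\<^sup>2 \<le> E * (E * B)" by (simp add: power2_eq_square algebra_simps)
      \<comment> \<open>Needed to cancel \<open>E\<close>. A strictly positive weight of integral 0
        would vanish almost everywhere, and Lebesgue measure is not null.\<close>
      moreover have "E > 0"
      proof (rule ccontr)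
        assume "\<not> E > 0"
        then have "E = 0" using \<open>E \<ge> 0\<close> by simp
        then have "AE y in lborel. e y = 0"
          unfolding E_def using e by (subst (asm) integral_nonneg_eq_0_iff_AE) (auto simp: less_imp_le)
        then have "AE y in (lborel :: real measure). False"
          by (rule eventually_mono) (use e(2) in \<open>metis less_irrefl\<close>)
        then show False by (simp add: eventually_False ae_filter_eq_bot_iff)
      qed
      ultimately have "A\<^sup>2 \<le> E * B" by simp
      then show ?case unfolding A_def[symmetric] B_def[symmetric] by simp
    qed
  qed measurable
qed

text \<open>A stochastic Fubini theorem. With \<open>Y\<close> the pathwise integral and \<open>Z = Re (I \<Phi>)\<close>, Fubini and the
  isometry show that \<open>Y - Z\<close> is orthogonal to every \<open>V y\<close> and to \<open>Z\<close>, hence to itself.\<close>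

lemma noise_fubini:
  fixes s :: "real \<Rightarrow> real \<Rightarrow> complex"
  assumes e: "integrable lborel e" "\<And>y. 0 < e y"
    and s [measurable]: "(\<lambda>(y, l). s y l) \<in> borel_measurable (lborel \<Otimes>\<^sub>M lborel)"
    and s_herm: "\<And>y. hermitian (s y)"
    and S: "sq_integrable S" "\<And>y l. cmod (s y l) \<le> cmod (S l)"
    and \<Phi>: "\<Phi> = (\<lambda>l. \<integral>y. complex_of_real (e y) * s y l \<partial>lborel)" "sq_integrable \<Phi>" "hermitian \<Phi>"
    and V [measurable]: "(\<lambda>(y, \<omega>). V y \<omega>) \<in> borel_measurable (lborel \<Otimes>\<^sub>M M)"
    and V_eq: "\<And>y. AE \<omega> in M. complex_of_real (V y \<omega>) = I (s y) \<omega>"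
  shows "AE \<omega> in M. integrable lborel (\<lambda>y. e y * V y \<omega>)"
    and "AE \<omega> in M. (\<integral>y. e y * V y \<omega> \<partial>lborel) = Re (I \<Phi> \<omega>)"
proof -
  interpret L: pair_sigma_finite lborel M ..
  note [measurable] = borel_measurable_integrable[OF e(1)]
  have [measurable]: "V y \<in> borel_measurable M" for y
    using measurable_compose_Pair1[OF _ V, of y] by simp
  have sm [measurable]: "s y \<in> borel_measurable borel" for y
    using measurable_compose_Pair1[OF _ s, of y] by simp
  have s_sq: "sq_integrable (s y)" for y
    using S by (intro sq_integrableI_bound[where g="\<lambda>l. (cmod (S l))\<^sup>2"] power_mono) (auto simp: sq_integrable_def)
  \<comment> \<open>The exceptional null set depends on \<open>y\<close>, so this replacement is
    made only inside expectations at fixed \<open>y\<close>, never under the pathwise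
    integral.\<close>
  have V_Re: "AE \<omega> in M. V y \<omega> = Re (I (s y) \<omega>)" for y
    using V_eq[of y] by eventually_elim (metis Re_complex_of_real)
  \<comment> \<open>The envelope \<open>S\<close> bounds all second moments at once, through the
    isometry.\<close>
  define K where "K = (\<integral>l. (cmod (S l))\<^sup>2 \<partial>lborel)"
  have cong: "expectation (\<lambda>\<omega>. V y \<omega> * \<zeta> \<omega>) = expectation (\<lambda>\<omega>. Re (I (s y) \<omega>) * \<zeta> \<omega>)"
    if [measurable]: "\<zeta> \<in> borel_measurable M" for y \<zeta>
    using V_Re[of y] measurable_noise[OF s_sq[of y]]
    by (intro integral_cong_AE) auto
  have V2_eq: "AE \<omega> in M. (V y \<omega>)\<^sup>2 = (Re (I (s y) \<omega>))\<^sup>2" for y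
    using V_Re[of y] by eventually_elim simp
  have V2: "integrable M (\<lambda>\<omega>. (V y \<omega>)\<^sup>2)" for y
    using integrable_cong_AE[OF _ _ V2_eq[of y]] integrable_Re_noise_sq[OF s_sq[of y]]
      measurable_noise[OF s_sq[of y]] by simp
  have V2_le: "expectation (\<lambda>\<omega>. (V y \<omega>)\<^sup>2) \<le> K" for y
  proof -
    have "expectation (\<lambda>\<omega>. (V y \<omega>)\<^sup>2) = expectation (\<lambda>\<omega>. (Re (I (s y) \<omega>))\<^sup>2)"
      using V2_eq[of y] measurable_noise[OF s_sq[of y]] by (intro integral_cong_AE) auto
    also have "\<dots> \<le> K"
      unfolding noise_variance[OF s_sq s_herm] K_def
      using S s_sq[of y] by (intro integral_mono power_mono) (auto simp: sq_integrable_def)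
    finally show ?thesis .
  qed
  define Y Z where "Y = (\<lambda>\<omega>. \<integral>y. e y * V y \<omega> \<partial>lborel)" and "Z = (\<lambda>\<omega>. Re (I \<Phi> \<omega>))"
  have Ym [measurable]: "Y \<in> borel_measurable M" unfolding Y_def by measurable
  have Zm [measurable]: "Z \<in> borel_measurable M" unfolding Z_def using measurable_noise[OF \<Phi>(2)] by measurable
  have Y2: "integrable M (\<lambda>\<omega>. (Y \<omega>)\<^sup>2)"
    unfolding Y_def by (rule integrable_square_weighted_integral[OF e V V2 V2_le])
  have Z2: "integrable M (\<lambda>\<omega>. (Z \<omega>)\<^sup>2)"
    unfolding Z_def by (rule integrable_Re_noise_sq[OF \<Phi>(2)])
  \<comment> \<open>Testing \<open>Y\<close> against a square-integrable variable reduces it to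
    expectations at fixed \<open>y\<close>.\<close>
  have prodV: "expectation (\<lambda>\<omega>. Y \<omega> * \<zeta> \<omega>) = (\<integral>y. e y * expectation (\<lambda>\<omega>. V y \<omega> * \<zeta> \<omega>) \<partial>lborel)"
    if [measurable]: "\<zeta> \<in> borel_measurable M" and "integrable M (\<lambda>\<omega>. (\<zeta> \<omega>)\<^sup>2)" for \<zeta>
  proof -
    have "expectation (\<lambda>\<omega>. Y \<omega> * \<zeta> \<omega>) = expectation (\<lambda>\<omega>. \<integral>y. e y * (V y \<omega> * \<zeta> \<omega>) \<partial>lborel)"
      by (simp add: Y_def mult.assoc[symmetric])
    also have "\<dots> = (\<integral>y. expectation (\<lambda>\<omega>. e y * (V y \<omega> * \<zeta> \<omega>)) \<partial>lborel)"
      using that by (intro L.Fubini_integral integrable_weighted_product[OF e(1) V V2 V2_le]) auto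
    finally show ?thesis by simp
  qed
  \<comment> \<open>The deterministic counterpart of the previous step: an inner product with \<Phi>
    is the weighted average of inner products with the \<open>s y\<close>. Cauchy-Schwarz against
    the envelope justifies the exchange.\<close>
  have kernel: "(\<integral>y. e y * Re (\<integral>l. s y l * cnj (\<psi> l) \<partial>lborel) \<partial>lborel) = Re (\<integral>l. \<Phi> l * cnj (\<psi> l) \<partial>lborel)"
    if \<psi>: "sq_integrable \<psi>" for \<psi>
  proof -
    have [measurable]: "\<psi> \<in> borel_measurable borel" "S \<in> borel_measurable borel"
      using \<psi> S by (auto simp: sq_integrable_def)
    have iS: "integrable lborel (\<lambda>l. cmod (S l) * cmod (\<psi> l))"
      using S \<psi> by (intro integrable_mult_of_squares) (auto simp: sq_integrable_def)
    have is\<psi>: "integrable lborel (\<lambda>l. s y l * cnj (\<psi> l))" for y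
      by (rule Bochner_Integration.integrable_bound[OF iS])
         (use S in \<open>auto simp: norm_mult intro!: mult_right_mono\<close>)
    have int: "integrable (lborel \<Otimes>\<^sub>M lborel) (\<lambda>(y, l). complex_of_real (e y) * (s y l * cnj (\<psi> l)))"
    proof (rule lborel_pair.Fubini_integrable)
      show "integrable lborel (\<lambda>y. \<integral>l. norm (case (y, l) of (y, l) \<Rightarrow> complex_of_real (e y) * (s y l * cnj (\<psi> l))) \<partial>lborel)"
      proof (rule Bochner_Integration.integrable_bound)
        show "integrable lborel (\<lambda>y. (\<integral>l. cmod (S l) * cmod (\<psi> l) \<partial>lborel) * e y)" using e by simp
        show "AE y in lborel. norm (\<integral>l. norm (case (y, l) of (y, l) \<Rightarrow> complex_of_real (e y) * (s y l * cnj (\<psi> l))) \<partial>lborel)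
            \<le> norm ((\<integral>l. cmod (S l) * cmod (\<psi> l) \<partial>lborel) * e y)"
        proof (intro AE_I2)
          fix y
          have "(\<integral>l. cmod (s y l) * cmod (\<psi> l) \<partial>lborel) \<le> (\<integral>l. cmod (S l) * cmod (\<psi> l) \<partial>lborel)"
            using integrable_norm[OF is\<psi>[of y]] S(2)
            by (intro integral_mono iS mult_right_mono) (auto simp: norm_mult)
          then have "e y * (\<integral>l. cmod (s y l) * cmod (\<psi> l) \<partial>lborel) \<le> e y * (\<integral>l. cmod (S l) * cmod (\<psi> l) \<partial>lborel)"
            using e(2)[of y] by (intro mult_left_mono) auto
          then show "norm (\<integral>l. norm (case (y, l) of (y, l) \<Rightarrow> complex_of_real (e y) * (s y l * cnj (\<psi> l))) \<partial>lborel)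
            \<le> norm ((\<integral>l. cmod (S l) * cmod (\<psi> l) \<partial>lborel) * e y)"
            using e(2)[of y] by (simp add: norm_mult abs_mult mult.commute)
        qed
      qed measurable
      show "AE y in lborel. integrable lborel (\<lambda>l. case (y, l) of (y, l) \<Rightarrow> complex_of_real (e y) * (s y l * cnj (\<psi> l)))"
        using is\<psi> by (intro AE_I2) simp
    qed measurable
    have "(\<integral>l. \<Phi> l * cnj (\<psi> l) \<partial>lborel) = (\<integral>l. (\<integral>y. complex_of_real (e y) * (s y l * cnj (\<psi> l)) \<partial>lborel) \<partial>lborel)"
      by (simp add: \<Phi>(1) mult.assoc[symmetric])
    also have "\<dots> = (\<integral>y. (\<integral>l. complex_of_real (e y) * (s y l * cnj (\<psi> l)) \<partial>lborel) \<partial>lborel)"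
      by (rule lborel_pair.Fubini_integral[OF int])
    also have "Re \<dots> = (\<integral>y. Re (\<integral>l. complex_of_real (e y) * (s y l * cnj (\<psi> l)) \<partial>lborel) \<partial>lborel)"
      by (rule integral_Re[OF lborel_pair.integrable_fst[OF int], symmetric])
    also have "\<dots> = (\<integral>y. e y * Re (\<integral>l. s y l * cnj (\<psi> l) \<partial>lborel) \<partial>lborel)"
      by simp
    finally show ?thesis by simp
  qed
  have VZ: "expectation (\<lambda>\<omega>. V y \<omega> * Z \<omega>) = Re (\<integral>l. s y l * cnj (\<Phi> l) \<partial>lborel)" for y
    unfolding cong[OF Zm] unfolding Z_def by (rule noise_covariance[OF s_sq s_herm \<Phi>(2,3)])
  have YV: "expectation (\<lambda>\<omega>. Y \<omega> * V y \<omega>) = Re (\<integral>l. \<Phi> l * cnj (s y l) \<partial>lborel)" for y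
  proof -
    have "expectation (\<lambda>\<omega>. V y' \<omega> * V y \<omega>) = Re (\<integral>l. s y' l * cnj (s y l) \<partial>lborel)" for y'
    proof -
      have "expectation (\<lambda>\<omega>. V y' \<omega> * V y \<omega>) = expectation (\<lambda>\<omega>. Re (I (s y') \<omega>) * Re (I (s y) \<omega>))"
        using V_Re[of y] V_Re[of y'] measurable_noise[OF s_sq[of y]] measurable_noise[OF s_sq[of y']]
        by (intro integral_cong_AE) auto
      then show ?thesis by (simp add: noise_covariance s_sq s_herm)
    qed
    then show ?thesis using prodV[of "V y"] kernel[OF s_sq[of y]] V2[of y] by simp
  qed
  \<comment> \<open>The complex inner product is only conjugate-symmetric; its real part is
    symmetric, as a covariance must be.\<close>
  have Re_swap: "Re (\<integral>l. f l * cnj (g l) \<partial>lborel) = Re (\<integral>l. g l * cnj (f l) \<partial>lborel)" for f g :: "real \<Rightarrow> complex"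
  proof -
    have "(\<integral>l. f l * cnj (g l) \<partial>lborel) = (\<integral>l. cnj (g l * cnj (f l)) \<partial>lborel)" by (simp add: mult.commute)
    also have "\<dots> = cnj (\<integral>l. g l * cnj (f l) \<partial>lborel)" by (rule Bochner_Integration.integral_cnj)
    finally show ?thesis by simp
  qed
  have "expectation (\<lambda>\<omega>. V y \<omega> * Y \<omega>) = expectation (\<lambda>\<omega>. V y \<omega> * Z \<omega>)" for y
    unfolding VZ Re_swap[of "s y"] YV[symmetric] by (simp add: mult.commute)
  \<comment> \<open>Both sides are averages over \<open>y\<close> of expectations of
    \<open>V y\<close> against \<open>Y\<close> and against \<open>Z\<close>, which agree for each
    \<open>y\<close>.\<close>
  then have YY: "expectation (\<lambda>\<omega>. Y \<omega> * Y \<omega>) = expectation (\<lambda>\<omega>. Y \<omega> * Z \<omega>)"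
    using prodV[OF Ym Y2] prodV[OF Zm Z2] by simp
  have YZ: "expectation (\<lambda>\<omega>. Y \<omega> * Z \<omega>) = expectation (\<lambda>\<omega>. Z \<omega> * Z \<omega>)"
    unfolding prodV[OF Zm Z2] VZ kernel[OF \<Phi>(2)]
    using noise_covariance[OF \<Phi>(2,3) \<Phi>(2,3)] by (simp add: Z_def)
  have i: "integrable M (\<lambda>\<omega>. Y \<omega> * Y \<omega>)" "integrable M (\<lambda>\<omega>. Y \<omega> * Z \<omega>)" "integrable M (\<lambda>\<omega>. Z \<omega> * Z \<omega>)"
    using Y2 Z2 by (auto intro!: integrable_mult_of_squares)
  have "expectation (\<lambda>\<omega>. (Y \<omega> - Z \<omega>)\<^sup>2) = expectation (\<lambda>\<omega>. (Y \<omega> * Y \<omega> - 2 * (Y \<omega> * Z \<omega>)) + Z \<omega> * Z \<omega>)"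
    by (simp add: power2_eq_square algebra_simps)
  also have "\<dots> = 0" using i YY YZ by simp
  finally have "expectation (\<lambda>\<omega>. (Y \<omega> - Z \<omega>)\<^sup>2) = 0" .
  moreover have "integrable M (\<lambda>\<omega>. (Y \<omega> - Z \<omega>)\<^sup>2)"
  proof -
    have "integrable M (\<lambda>\<omega>. (Y \<omega> * Y \<omega> - 2 * (Y \<omega> * Z \<omega>)) + Z \<omega> * Z \<omega>)" using i by simp
    then show ?thesis by (simp add: power2_eq_square algebra_simps)
  qed
  ultimately have "AE \<omega> in M. (Y \<omega> - Z \<omega>)\<^sup>2 = 0"
    by (subst (asm) integral_nonneg_eq_0_iff_AE) auto
  then show "AE \<omega> in M. (\<integral>y. e y * V y \<omega> \<partial>lborel) = Re (I \<Phi> \<omega>)"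
    by (simp add: Y_def Z_def)
  have "integrable (lborel \<Otimes>\<^sub>M M) (\<lambda>(y, \<omega>). e y * V y \<omega>)"
    using integrable_weighted_product[OF e(1) V V2 V2_le, of "\<lambda>_. 1"] by simp
  then show "AE \<omega> in M. integrable lborel (\<lambda>y. e y * V y \<omega>)"
    by (rule L.AE_integrable_snd)
qed

end

subsection \<open>The averaged field\<close>

text \<open>The substitution \<open>y = x + z / sqrt 2\<close> turns the weight into a multiple of
  the standard normal density, and the integral into its characteristic function at
  \<open>a / sqrt 2\<close>.\<close>

lemma integral_gaussian_fourier:
  fixes a x :: real
  shows "(\<integral>y. complex_of_real (exp (- (y - x)\<^sup>2)) * exp (\<i> * complex_of_real (a * y)) \<partial>lborel)
      = complex_of_real (sqrt pi * exp (- a\<^sup>2 / 4)) * exp (\<i> * complex_of_real (a * x))"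
proof -
  have "(\<integral>y. complex_of_real (exp (- (y - x)\<^sup>2)) * exp (\<i> * complex_of_real (a * y)) \<partial>lborel)
      = (1 / sqrt 2) *\<^sub>R (\<integral>z. complex_of_real (exp (- (1 / sqrt 2 * z)\<^sup>2)) * exp (\<i> * complex_of_real (a * (x + 1 / sqrt 2 * z))) \<partial>lborel)"
    by (subst lborel_integral_real_affine[where c="1 / sqrt 2" and t=x]) simp_all
  also have "(\<lambda>z. complex_of_real (exp (- (1 / sqrt 2 * z)\<^sup>2)) * exp (\<i> * complex_of_real (a * (x + 1 / sqrt 2 * z))))
      = (\<lambda>z. (complex_of_real (sqrt (2 * pi)) * exp (\<i> * complex_of_real (a * x))) *
           (std_normal_density z *\<^sub>R iexp (a / sqrt 2 * z)))"
  proof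
    fix z :: real
    have "\<i> * complex_of_real (a * (x + 1 / sqrt 2 * z)) = \<i> * complex_of_real (a * x) + \<i> * complex_of_real (a / sqrt 2 * z)"
      by (simp add: algebra_simps)
    then have 1: "exp (\<i> * complex_of_real (a * (x + 1 / sqrt 2 * z))) = exp (\<i> * complex_of_real (a * x)) * iexp (a / sqrt 2 * z)"
      by (simp only: exp_add)
    have "exp (- (1 / sqrt 2 * z)\<^sup>2) = sqrt (2 * pi) * std_normal_density z"
      by (simp add: std_normal_density_def power_mult_distrib power_divide)
    then have 2: "complex_of_real (exp (- (1 / sqrt 2 * z)\<^sup>2)) = complex_of_real (sqrt (2 * pi)) * complex_of_real (std_normal_density z)"
      by (simp only: of_real_mult)
    show "complex_of_real (exp (- (1 / sqrt 2 * z)\<^sup>2)) * exp (\<i> * complex_of_real (a * (x + 1 / sqrt 2 * z)))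
      = (complex_of_real (sqrt (2 * pi)) * exp (\<i> * complex_of_real (a * x))) * (std_normal_density z *\<^sub>R iexp (a / sqrt 2 * z))"
      unfolding 1 2 scaleR_conv_of_real by (simp only: ac_simps)
  qed
  also have "(\<integral>z. (complex_of_real (sqrt (2 * pi)) * exp (\<i> * complex_of_real (a * x))) *
           (std_normal_density z *\<^sub>R iexp (a / sqrt 2 * z)) \<partial>lborel)
      = (complex_of_real (sqrt (2 * pi)) * exp (\<i> * complex_of_real (a * x))) * char std_normal_distribution (a / sqrt 2)"
    unfolding char_def integral_mult_right_zero by (subst integral_density) auto
  also have "char std_normal_distribution (a / sqrt 2) = complex_of_real (exp (- a\<^sup>2 / 4))"
    by (simp add: char_std_normal_distribution power_divide)
  finally show ?thesis
    by (simp add: scaleR_conv_of_real real_sqrt_mult)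
qed

text \<open>The plane wave of frequency \<open>l\<close> that solves the equation of order
  \<open>2 * k + 1\<close>: each space derivative gives a factor \<open>\<i> * l\<close>, and the
  odd power of \<open>\<i>\<close> is \<open>(-1) ^ k * \<i>\<close>.\<close>

definition wave :: "real \<Rightarrow> nat \<Rightarrow> real \<Rightarrow> real \<Rightarrow> real \<Rightarrow> complex" where
  "wave \<mu> k t x l = exp (\<i> * complex_of_real (l * x + \<mu> * (-1) ^ k * l ^ (2 * k + 1) * t))"

lemma norm_wave [simp]: "cmod (wave \<mu> k t x l) = 1"
  unfolding wave_def by (rule norm_exp_i_times)

lemma measurable_wave [measurable]: "wave \<mu> k t x \<in> borel_measurable borel"
  unfolding wave_def[abs_def] by (intro borel_measurable_continuous_onI continuous_intros)

text \<open>Odd order enters here: the phase is an odd function of \<open>l\<close>, so waves are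
  hermitian.\<close>

lemma cnj_wave_minus: "cnj (wave \<mu> k t x (- l)) = wave \<mu> k t x l"
proof -
  have "- (- l * x + \<mu> * (-1) ^ k * (- l) ^ (2 * k + 1) * t) = l * x + \<mu> * (-1) ^ k * l ^ (2 * k + 1) * t"
    by simp
  then show ?thesis unfolding wave_def cis_conv_exp[symmetric] cis_cnj by (simp only:)
qed

lemma wave_dilate: "wave \<mu> k (t * c ^ (2 * k + 1)) (c * x) l = wave \<mu> k t x (c * l)"
  by (simp add: wave_def power_mult_distrib mult_ac)

lemma wave_cnj_wave:
  "wave \<mu> k t x l * cnj (wave \<mu> k t' x' l) =
     exp (\<i> * complex_of_real (l * (x - x') + \<mu> * (-1) ^ k * (t - t') * l ^ (2 * k + 1)))"
proof -
  have "(l * x + \<mu> * (-1) ^ k * l ^ (2 * k + 1) * t) + - (l * x' + \<mu> * (-1) ^ k * l ^ (2 * k + 1) * t')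
      = l * (x - x') + \<mu> * (-1) ^ k * (t - t') * l ^ (2 * k + 1)"
    by (simp add: algebra_simps)
  then show ?thesis unfolding wave_def cis_conv_exp[symmetric] cis_cnj cis_mult by (simp only:)
qed

section \<open>Finite vectors of noise integrals\<close>

context white_noise
begin

lemma measurable_noise_vec:
  fixes \<phi> :: "'i::finite \<Rightarrow> real \<Rightarrow> complex"
  assumes "\<And>i. sq_integrable (\<phi> i)"
  shows "(\<lambda>\<omega>. \<chi> i. Re (I (\<phi> i) \<omega>)) \<in> borel_measurable M"
  using measurable_noise[OF assms]
  by (subst borel_measurable_euclidean_space) (auto simp: Basis_vec_def inner_axis)

text \<open>Joint Gaussianity comes from linearity: a real linear combination of the components is
  almost surely the real part of one noise integral, to which the scalar formula applies.\<close>

lemma noise_vec_cos: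
  fixes \<phi> :: "'i::finite \<Rightarrow> real \<Rightarrow> complex"
  assumes \<phi>: "\<And>i. sq_integrable (\<phi> i)" "\<And>i. hermitian (\<phi> i)"
  shows "expectation (\<lambda>\<omega>. cos (u \<bullet> (\<chi> i. Re (I (\<phi> i) \<omega>)) + b)) =
    cos b * exp (- (\<integral>l. (cmod (\<Sum>i\<in>UNIV. complex_of_real (u $ i) * \<phi> i l))\<^sup>2 \<partial>lborel) / 2)"
proof -
  let ?\<phi> = "\<lambda>l. \<Sum>i\<in>UNIV. complex_of_real (u $ i) * \<phi> i l"
  have sq: "sq_integrable ?\<phi>" by (intro sq_integrable_sum sq_integrable_mult_const \<phi>)
  have herm: "hermitian ?\<phi>" using \<phi>(2) by (simp add: hermitian_def)
  have "AE \<omega> in M. u \<bullet> (\<chi> i. Re (I (\<phi> i) \<omega>)) = Re (I ?\<phi> \<omega>)"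
    using noise_sum[of UNIV \<phi> "\<lambda>i. complex_of_real (u $ i)"] \<phi>(1)
    by (auto simp: inner_vec_def elim!: eventually_mono)
  then have "expectation (\<lambda>\<omega>. cos (u \<bullet> (\<chi> i. Re (I (\<phi> i) \<omega>)) + b)) = expectation (\<lambda>\<omega>. cos (Re (I ?\<phi> \<omega>) + b))"
    using measurable_noise[OF sq] measurable_noise_vec[of \<phi>, OF \<phi>(1)]
    by (intro integral_cong_AE) auto
  then show ?thesis using noise_cos[OF sq herm] by simp
qed

lemma noise_vec_norm_sq:
  fixes \<phi> :: "'i::finite \<Rightarrow> real \<Rightarrow> complex"
  assumes \<phi>: "\<And>i. sq_integrable (\<phi> i)" "\<And>i. hermitian (\<phi> i)"
  shows "integrable M (\<lambda>\<omega>. (norm (\<chi> i. Re (I (\<phi> i) \<omega>)))\<^sup>2)"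
    and "expectation (\<lambda>\<omega>. (norm (\<chi> i. Re (I (\<phi> i) \<omega>)))\<^sup>2) = (\<Sum>i\<in>UNIV. \<integral>l. (cmod (\<phi> i l))\<^sup>2 \<partial>lborel)"
proof -
  have *: "(norm (\<chi> i. Re (I (\<phi> i) \<omega>)))\<^sup>2 = (\<Sum>i\<in>UNIV. (Re (I (\<phi> i) \<omega>))\<^sup>2)" for \<omega>
    unfolding power2_norm_eq_inner by (simp add: inner_vec_def power2_eq_square)
  show "integrable M (\<lambda>\<omega>. (norm (\<chi> i. Re (I (\<phi> i) \<omega>)))\<^sup>2)"
    unfolding * by (intro Bochner_Integration.integrable_sum integrable_Re_noise_sq \<phi>)
  show "expectation (\<lambda>\<omega>. (norm (\<chi> i. Re (I (\<phi> i) \<omega>)))\<^sup>2) = (\<Sum>i\<in>UNIV. \<integral>l. (cmod (\<phi> i l))\<^sup>2 \<partial>lborel)"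
    unfolding * by (simp add: Bochner_Integration.integral_sum integrable_Re_noise_sq noise_variance \<phi>)
qed

text \<open>Centred Gaussian vectors are governed by the quadratic forms of their variances, so
  convergence of these forms gives both the cosine expectations and the moment bound.\<close>

lemma weak_conv_vec_noise:
  fixes \<phi> :: "real \<Rightarrow> 'i::finite \<Rightarrow> real \<Rightarrow> complex"
  assumes \<phi>: "\<And>e i. sq_integrable (\<phi> e i)" "\<And>e i. hermitian (\<phi> e i)"
    and \<psi>: "\<And>i. sq_integrable (\<psi> i)" "\<And>i. hermitian (\<psi> i)"
    and lim: "\<And>u :: real ^ 'i. ((\<lambda>e. \<integral>l. (cmod (\<Sum>i\<in>UNIV. complex_of_real (u $ i) * \<phi> e i l))\<^sup>2 \<partial>lborel)
        \<longlongrightarrow> (\<integral>l. (cmod (\<Sum>i\<in>UNIV. complex_of_real (u $ i) * \<psi> i l))\<^sup>2 \<partial>lborel)) F"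
  shows "weak_conv_vec (\<lambda>e. distr M borel (\<lambda>\<omega>. \<chi> i. Re (I (\<phi> e i) \<omega>)))
      (distr M borel (\<lambda>\<omega>. \<chi> i. Re (I (\<psi> i) \<omega>))) F"
proof (rule weak_conv_vec_cosI)
  show "random_variable borel (\<lambda>\<omega>. \<chi> i. Re (I (\<phi> e i) \<omega>))" for e by (rule measurable_noise_vec[OF \<phi>(1)])
  show "random_variable borel (\<lambda>\<omega>. \<chi> i. Re (I (\<psi> i) \<omega>))" by (rule measurable_noise_vec[OF \<psi>(1)])
  show "((\<lambda>e. expectation (\<lambda>\<omega>. cos (u \<bullet> (\<chi> i. Re (I (\<phi> e i) \<omega>)) + b)))
      \<longlongrightarrow> expectation (\<lambda>\<omega>. cos (u \<bullet> (\<chi> i. Re (I (\<psi> i) \<omega>)) + b))) F" for u b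
    unfolding noise_vec_cos[OF \<phi>] noise_vec_cos[OF \<psi>] by (intro tendsto_intros lim) auto
  show "integrable M (\<lambda>\<omega>. (norm (\<chi> i. Re (I (\<psi> i) \<omega>)))\<^sup>2)" by (rule noise_vec_norm_sq(1)[OF \<psi>])
  let ?L = "\<Sum>i\<in>UNIV. \<integral>l. (cmod (\<psi> i l))\<^sup>2 \<partial>lborel"
  \<comment> \<open>Unit vectors \<open>u\<close> extract the single variances from the hypothesis,
    and their sum is the second moment of the norm.\<close>
  have axis: "(\<Sum>j\<in>UNIV. complex_of_real (axis i 1 $ j) * f j) = f i" for i :: 'i and f
  proof -
    have "(\<Sum>j\<in>UNIV. complex_of_real (axis i 1 $ j) * f j) = (\<Sum>j\<in>UNIV. if j = i then f j else 0)"
      by (intro sum.cong) (auto simp: axis_def)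
    then show ?thesis by simp
  qed
  have "((\<lambda>e. \<Sum>i\<in>UNIV. \<integral>l. (cmod (\<phi> e i l))\<^sup>2 \<partial>lborel) \<longlongrightarrow> ?L) F"
    using lim[of "axis _ 1"] unfolding axis by (intro tendsto_sum)
  then have "\<forall>\<^sub>F e in F. (\<Sum>i\<in>UNIV. \<integral>l. (cmod (\<phi> e i l))\<^sup>2 \<partial>lborel) < ?L + 1"
    by (rule order_tendstoD) simp
  then show "\<forall>\<^sub>F e in F. integrable M (\<lambda>\<omega>. (norm (\<chi> i. Re (I (\<phi> e i) \<omega>)))\<^sup>2)
      \<and> expectation (\<lambda>\<omega>. (norm (\<chi> i. Re (I (\<phi> e i) \<omega>)))\<^sup>2) \<le> ?L + 1"
    by eventually_elim (simp add: noise_vec_norm_sq[OF \<phi>])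
qed

end

text \<open>The field is identified with a noise integral only for positive \<epsilon>, that is,
  eventually in \<open>at_right 0\<close>.\<close>

lemma weak_conv_vec_cong:
  assumes "weak_conv_vec m n F" "\<forall>\<^sub>F e in F. m' e = m e"
  shows "weak_conv_vec m' n F"
  unfolding weak_conv_vec_def
proof (intro allI impI)
  fix g :: "'a \<Rightarrow> real"
  assume "continuous_on UNIV g \<and> bounded (range g)"
  then have "((\<lambda>e. \<integral>x. g x \<partial>m e) \<longlongrightarrow> (\<integral>x. g x \<partial>n)) F"
    using assms(1) by (simp add: weak_conv_vec_def)
  moreover have "\<forall>\<^sub>F e in F. (\<integral>x. g x \<partial>m e) = (\<integral>x. g x \<partial>m' e)"
    using assms(2) by eventually_elim simp
  ultimately show "((\<lambda>e. \<integral>x. g x \<partial>m' e) \<longlongrightarrow> (\<integral>x. g x \<partial>n)) F"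
    by (rule Lim_transform_eventually)
qed

text \<open>The spectral kernel of the Gaussian average at scale \<open>c\<close>, used with
  \<open>c = \<epsilon> powr (-1/2)\<close>. The prefactor is \<open>1 / (2 * pi)\<close> from the
  solution times \<open>sqrt pi\<close> from the Fourier transform of the Gaussian.\<close>

definition averaged_kernel :: "real \<Rightarrow> nat \<Rightarrow> (real \<Rightarrow> real) \<Rightarrow> real \<Rightarrow> real \<Rightarrow> real \<Rightarrow> real \<Rightarrow> complex" where
  "averaged_kernel \<mu> k f c t x l = complex_of_real (exp (- (c * l)\<^sup>2 / 4) * sqrt (f l))
     * (complex_of_real (1 / (2 * sqrt pi)) * wave \<mu> k t x (c * l))"

lemma solker_eq_wave:
  "solker \<mu> k n A w \<kappa> t x l = complex_of_real (1 / (2 * pi)) * wave \<mu> k t x l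
     * complex_of_real (sqrt (specdens n A w \<kappa> l))"
  by (simp only: solker_def wave_def)

lemma integral_gaussian_solker:
  "(\<integral>y. complex_of_real (exp (- (y - x)\<^sup>2)) * solker \<mu> k n A w \<kappa> (t * c ^ (2 * k + 1)) (c * y) l \<partial>lborel)
     = averaged_kernel \<mu> k (specdens n A w \<kappa>) c t x l"
proof -
  let ?T = "t * c ^ (2 * k + 1)"
  let ?B = "exp (\<i> * complex_of_real (\<mu> * (-1) ^ k * l ^ (2 * k + 1) * ?T))"
  let ?s = "complex_of_real (sqrt (specdens n A w \<kappa> l))"
  have wave_split: "wave \<mu> k ?T (c * y) l = ?B * exp (\<i> * complex_of_real ((c * l) * y))" for y
    unfolding wave_def exp_add[symmetric] by (simp add: algebra_simps)
  have "(\<integral>y. complex_of_real (exp (- (y - x)\<^sup>2)) * solker \<mu> k n A w \<kappa> ?T (c * y) l \<partial>lborel)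
      = (\<integral>y. (complex_of_real (1 / (2 * pi)) * ?B * ?s) *
          (complex_of_real (exp (- (y - x)\<^sup>2)) * exp (\<i> * complex_of_real ((c * l) * y))) \<partial>lborel)"
    unfolding solker_eq_wave wave_split by (simp only: ac_simps)
  also have "\<dots> = (complex_of_real (1 / (2 * pi)) * ?B * ?s) *
      (complex_of_real (sqrt pi * exp (- (c * l)\<^sup>2 / 4)) * exp (\<i> * complex_of_real ((c * l) * x)))"
    unfolding integral_mult_right_zero integral_gaussian_fourier ..
  also have "\<dots> = complex_of_real (1 / (2 * pi) * sqrt pi) * complex_of_real (exp (- (c * l)\<^sup>2 / 4) * sqrt (specdens n A w \<kappa> l))
      * (?B * exp (\<i> * complex_of_real ((c * l) * x)))"
    unfolding of_real_mult by (simp only: ac_simps)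
  also have "?B * exp (\<i> * complex_of_real ((c * l) * x)) = wave \<mu> k t x (c * l)"
    unfolding wave_split[symmetric] by (rule wave_dilate)
  also have "1 / (2 * pi) * sqrt pi = 1 / (2 * sqrt pi)"
    by (simp add: field_simps)
  finally show ?thesis unfolding averaged_kernel_def by (simp only: ac_simps)
qed

lemma norm_averaged_kernel_sq:
  assumes "0 \<le> f l"
  shows "(cmod (averaged_kernel \<mu> k f c t x l))\<^sup>2 = exp (- (c * l)\<^sup>2 / 2) * f l / (4 * pi)"
  using assms
  by (simp add: averaged_kernel_def norm_mult norm_divide power_mult_distrib power_divide exp_double[symmetric])

lemma sq_integrable_averaged_kernel:
  assumes f: "integrable lborel f" "\<And>l. 0 \<le> f l"
  shows "sq_integrable (averaged_kernel \<mu> k f c t x)"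
proof (rule sq_integrableI_bound)
  note [measurable] = borel_measurable_integrable[OF f(1)]
  show "averaged_kernel \<mu> k f c t x \<in> borel_measurable borel"
    unfolding averaged_kernel_def[abs_def] by measurable
  show "integrable lborel (\<lambda>l. f l / (4 * pi))" using f by simp
  fix l
  have "exp (- (c * l)\<^sup>2 / 2) * f l \<le> 1 * f l" using f(2) by (intro mult_right_mono) auto
  then show "(cmod (averaged_kernel \<mu> k f c t x l))\<^sup>2 \<le> f l / (4 * pi)"
    unfolding norm_averaged_kernel_sq[of f l, OF f(2)] by (intro divide_right_mono) auto
qed

lemma hermitian_averaged_kernel:
  assumes "\<And>l. f (- l) = f l"
  shows "hermitian (averaged_kernel \<mu> k f c t x)"
  using cnj_wave_minus[of \<mu> k t x "c * _"] by (simp add: hermitian_def averaged_kernel_def assms)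

lemma tendsto_integral_averaged_kernels:
  fixes f :: "real \<Rightarrow> real" and u :: "real ^ 'i::finite"
  assumes f: "integrable lborel f" "\<And>l. 0 \<le> f l" "isCont f 0"
  shows "((\<lambda>\<epsilon>. \<integral>l. (cmod (\<Sum>i\<in>UNIV. complex_of_real (u $ i) *
            (complex_of_real (\<epsilon> powr (-1/4)) * averaged_kernel \<mu> k f (\<epsilon> powr (-1/2)) (ts i) (xs i) l)))\<^sup>2 \<partial>lborel)
      \<longlongrightarrow> (\<integral>l. (cmod (\<Sum>i\<in>UNIV. complex_of_real (u $ i) *
            (complex_of_real (sqrt (f 0) / (2 * sqrt pi)) * (wave \<mu> k (ts i) (xs i) l * complex_of_real (exp (- l\<^sup>2 / 4))))))\<^sup>2 \<partial>lborel))
      (at_right 0)"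
proof -
  \<comment> \<open>The amplitude and the density are common to all indices and factor out of the
    sum; \<open>H\<close> is the bounded, \<epsilon>-free rest.\<close>
  define H where "H l = (\<Sum>i\<in>UNIV. complex_of_real (u $ i) * (complex_of_real (1 / (2 * sqrt pi)) * wave \<mu> k (ts i) (xs i) l))" for l
  define h where "h l = (cmod (H l))\<^sup>2" for l
  define B where "B = (\<Sum>i\<in>UNIV. \<bar>u $ i\<bar> * (1 / (2 * sqrt pi)))\<^sup>2"
  have [measurable]: "h \<in> borel_measurable borel" unfolding h_def H_def by measurable
  have hB: "\<bar>h l\<bar> \<le> B" for l
  proof -
    have "cmod (H l) \<le> (\<Sum>i\<in>UNIV. \<bar>u $ i\<bar> * (1 / (2 * sqrt pi)))"
      unfolding H_def by (rule order_trans[OF norm_sum]) (simp add: norm_mult norm_divide)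
    then show ?thesis unfolding h_def B_def abs_power2 by (intro power_mono) auto
  qed
  have limit: "(\<integral>l. (cmod (\<Sum>i\<in>UNIV. complex_of_real (u $ i) *
            (complex_of_real (sqrt (f 0) / (2 * sqrt pi)) * (wave \<mu> k (ts i) (xs i) l * complex_of_real (exp (- l\<^sup>2 / 4))))))\<^sup>2 \<partial>lborel)
        = f 0 * (\<integral>l. h l * exp (- l\<^sup>2 / 2) \<partial>lborel)"
  proof -
    have "(cmod (\<Sum>i\<in>UNIV. complex_of_real (u $ i) *
            (complex_of_real (sqrt (f 0) / (2 * sqrt pi)) * (wave \<mu> k (ts i) (xs i) l * complex_of_real (exp (- l\<^sup>2 / 4))))))\<^sup>2
        = f 0 * (h l * exp (- l\<^sup>2 / 2))" for l
    proof -
      have "(\<Sum>i\<in>UNIV. complex_of_real (u $ i) *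
            (complex_of_real (sqrt (f 0) / (2 * sqrt pi)) * (wave \<mu> k (ts i) (xs i) l * complex_of_real (exp (- l\<^sup>2 / 4)))))
          = complex_of_real (sqrt (f 0) * exp (- l\<^sup>2 / 4)) * H l"
        by (simp add: H_def sum_distrib_left mult_ac)
      then show ?thesis
        using f(2)[of 0] by (simp add: h_def norm_mult power_mult_distrib exp_double[symmetric])
    qed
    then show ?thesis by simp
  qed
  have scaled: "(\<integral>l. (cmod (\<Sum>i\<in>UNIV. complex_of_real (u $ i) *
            (complex_of_real (\<epsilon> powr (-1/4)) * averaged_kernel \<mu> k f (\<epsilon> powr (-1/2)) (ts i) (xs i) l)))\<^sup>2 \<partial>lborel)
        = (\<integral>l. h l * exp (- l\<^sup>2 / 2) * f (sqrt \<epsilon> * l) \<partial>lborel)" if "0 < \<epsilon>" for \<epsilon>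
  proof -
    define c where "c = \<epsilon> powr (-1/2)"
    have c: "c * sqrt \<epsilon> = 1" "sqrt \<epsilon> > 0"
      using that by (simp_all add: c_def powr_half_sqrt[symmetric] powr_add[symmetric])
    have c4: "(\<epsilon> powr (-1/4))\<^sup>2 = c"
      using that by (simp add: c_def power2_eq_square powr_add[symmetric])
    have "(cmod (\<Sum>i\<in>UNIV. complex_of_real (u $ i) *
            (complex_of_real (\<epsilon> powr (-1/4)) * averaged_kernel \<mu> k f c (ts i) (xs i) l)))\<^sup>2
          = c * (h (c * l) * exp (- (c * l)\<^sup>2 / 2) * f l)" for l
    proof -
      have "(\<Sum>i\<in>UNIV. complex_of_real (u $ i) *
            (complex_of_real (\<epsilon> powr (-1/4)) * averaged_kernel \<mu> k f c (ts i) (xs i) l))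
          = complex_of_real (\<epsilon> powr (-1/4) * (exp (- (c * l)\<^sup>2 / 4) * sqrt (f l))) * H (c * l)"
        by (simp add: H_def averaged_kernel_def sum_distrib_left mult_ac)
      then show ?thesis
        using f(2)[of l] by (simp add: h_def norm_mult power_mult_distrib exp_double[symmetric] c4[simplified])
    qed
    then have "(\<integral>l. (cmod (\<Sum>i\<in>UNIV. complex_of_real (u $ i) *
            (complex_of_real (\<epsilon> powr (-1/4)) * averaged_kernel \<mu> k f c (ts i) (xs i) l)))\<^sup>2 \<partial>lborel)
        = c * (\<integral>l. h (c * l) * exp (- (c * l)\<^sup>2 / 2) * f l \<partial>lborel)" by simp
    \<comment> \<open>Since \<open>c * sqrt \<epsilon> = 1\<close>, the Jacobian cancels the squared
      normalisation \<open>c\<close>, and the dependence on \<epsilon> moves from \<open>h\<close>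
      and the Gaussian into \<open>f\<close>.\<close>
    also have "\<dots> = c * (sqrt \<epsilon> * (\<integral>l. h (c * (sqrt \<epsilon> * l)) * exp (- (c * (sqrt \<epsilon> * l))\<^sup>2 / 2) * f (sqrt \<epsilon> * l) \<partial>lborel))"
      using c(2) by (subst lborel_integral_real_affine[where c="sqrt \<epsilon>" and t=0]) auto
    also have "\<dots> = (\<integral>l. h l * exp (- l\<^sup>2 / 2) * f (sqrt \<epsilon> * l) \<partial>lborel)"
      unfolding mult.assoc[of c "sqrt \<epsilon>", symmetric] c(1) by simp
    finally show ?thesis unfolding c_def .
  qed
  have "filterlim sqrt (at_right 0) (at_right 0)"
    by real_asymp
  from filterlim_compose[OF tendsto_integral_gaussian_dilation[OF f(1,3) _ hB] this]
  have "((\<lambda>\<epsilon>. \<integral>l. h l * exp (- l\<^sup>2 / 2) * f (sqrt \<epsilon> * l) \<partial>lborel)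
      \<longlongrightarrow> f 0 * (\<integral>l. h l * exp (- l\<^sup>2 / 2) \<partial>lborel)) (at_right 0)" by simp
  then show ?thesis
    unfolding limit
    by (rule Lim_transform_eventually, intro eventually_mono[OF eventually_at_right_less])
       (rule scaled[symmetric])
qed

text \<open>Measurability is a conclusion of its own because equality of laws is later deduced from
  an almost sure equality of measurable maps.\<close>

lemma (in white_noise) Ubar_eq_noise:
  fixes v :: "real \<Rightarrow> real \<Rightarrow> 'w \<Rightarrow> real"
  assumes A: "\<forall>j\<le>n. A j \<ge> 0" and \<kappa>: "\<forall>j\<le>n. 0 < \<kappa> j \<and> \<kappa> j < 1"
    and v_meas: "\<forall>t. (\<lambda>(x, \<omega>). v t x \<omega>) \<in> borel_measurable (lborel \<Otimes>\<^sub>M M)"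
    and v_version: "\<forall>t x. AE \<omega> in M. complex_of_real (v t x \<omega>) = I (solker \<mu> k n A w \<kappa> t x) \<omega>"
    and m_int: "\<forall>s c x. c > 0 \<longrightarrow>
                  integrable lborel (\<lambda>x1. exp (- (x1 - x)\<^sup>2) * Re (detpart m \<mu> k s (c * x1)))"
    and \<epsilon>: "0 < \<epsilon>"
  shows "Ubar M m \<mu> k v \<epsilon> t x \<in> borel_measurable M"
    and "AE \<omega> in M. Ubar M m \<mu> k v \<epsilon> t x \<omega> = Re (I (\<lambda>l. complex_of_real (\<epsilon> powr (-1/4)) *
           averaged_kernel \<mu> k (specdens n A w \<kappa>) (\<epsilon> powr (-1/2)) t x l) \<omega>)"
proof -
  define f where "f = specdens n A w \<kappa>"
  define c where "c = \<epsilon> powr (-1/2)"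
  define T where "T = t * c ^ (2 * k + 1)"
  define e where "e y = exp (- (y - x)\<^sup>2)" for y
  define V where "V y \<omega> = v T (c * y) \<omega>" for y \<omega>
  define s where "s y = solker \<mu> k n A w \<kappa> T (c * y)" for y
  define \<Phi> where "\<Phi> = averaged_kernel \<mu> k f c t x"
  \<comment> \<open>The contribution of the initial mean. It is deterministic and its integral
    equals \<open>expectation Y\<close>, so the centring removes exactly this part.\<close>
  define d where "d y = e y * Re (detpart m \<mu> k T (c * y))" for y
  define Y where "Y \<omega> = (\<integral>y. d y + e y * V y \<omega> \<partial>lborel)" for \<omega>
  have f: "integrable lborel f" "\<And>l. 0 \<le> f l" "\<And>l. f (- l) = f l"
    unfolding f_def using A \<kappa> by (auto intro: integrable_specdens specdens_nonneg specdens_minus)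
  note [measurable] = borel_measurable_integrable[OF f(1)]
  have c: "0 < c" using \<epsilon> by (simp add: c_def)
  \<comment> \<open>The real exponent of the time scale becomes a natural power of \<open>c\<close>,
    the form in which waves can be dilated.\<close>
  have T_eq: "t * \<epsilon> powr (- real (2 * k + 1) / 2) = T"
  proof -
    have "c ^ (2 * k + 1) = \<epsilon> powr (-1/2 * real (2 * k + 1))"
      using c unfolding c_def by (simp only: powr_realpow[symmetric] powr_powr)
    moreover have "-1/2 * real (2 * k + 1) = - real (2 * k + 1) / 2" by (simp add: field_simps)
    ultimately show ?thesis unfolding T_def by (simp only:)
  qed
  have Ubar_eq: "Ubar M m \<mu> k v \<epsilon> t x \<omega> = \<epsilon> powr (-1/4) * (Y \<omega> - expectation Y)" for \<omega>
    unfolding Ubar_def T_eq c_def[symmetric] Y_def d_def e_def V_def ufield_def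
    by (simp add: distrib_left mult.commute[of _ c])
  have d: "integrable lborel d" unfolding d_def e_def using m_int c by blast
  note [measurable] = borel_measurable_integrable[OF d]
  have e: "integrable lborel e" "\<And>y. 0 < e y"
    using lborel_integrable_real_affine[OF integrable_gaussian[of 1], of 1 "- x"] by (auto simp: e_def[abs_def])
  note [measurable] = borel_measurable_integrable[OF e(1)]
  have V_meas [measurable]: "(\<lambda>(y, \<omega>). V y \<omega>) \<in> borel_measurable (lborel \<Otimes>\<^sub>M M)"
  proof -
    have "(\<lambda>p. case (c * fst p, snd p) of (x, \<omega>) \<Rightarrow> v T x \<omega>) \<in> borel_measurable (lborel \<Otimes>\<^sub>M M)"
      by (rule measurable_compose[OF _ v_meas[rule_format]]) measurable
    then show ?thesis by (simp add: V_def split_beta)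
  qed
  have s_wave: "s y l = complex_of_real (1 / (2 * pi)) * wave \<mu> k T (c * y) l * complex_of_real (sqrt (f l))" for y l
    unfolding s_def f_def by (rule solker_eq_wave)
  \<comment> \<open>Dropping the unimodular wave leaves a square-integrable envelope independent of
    \<open>y\<close>.\<close>
  define S where "S l = complex_of_real (1 / (2 * pi)) * complex_of_real (sqrt (f l))" for l
  have S: "sq_integrable S"
  proof (rule sq_integrableI_bound)
    show "S \<in> borel_measurable borel" unfolding S_def[abs_def] by measurable
    show "integrable lborel (\<lambda>l. f l * (1 / (2 * pi))\<^sup>2)" using f(1) by simp
    show "(cmod (S l))\<^sup>2 \<le> f l * (1 / (2 * pi))\<^sup>2" for l
      using f(2)[of l] by (simp add: S_def norm_mult norm_divide power_mult_distrib power_divide)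
  qed
  have \<Phi>: "sq_integrable \<Phi>" "hermitian \<Phi>"
    unfolding \<Phi>_def
    by (rule sq_integrable_averaged_kernel[of f, OF f(1,2)] hermitian_averaged_kernel[of f, OF f(3)])+
  have \<Phi>_eq: "\<Phi> = (\<lambda>l. \<integral>y. complex_of_real (e y) * s y l \<partial>lborel)"
    unfolding \<Phi>_def e_def s_def T_def f_def integral_gaussian_solker ..
  have s_meas: "(\<lambda>(y, l). s y l) \<in> borel_measurable (lborel \<Otimes>\<^sub>M lborel)"
    unfolding s_wave wave_def by measurable
  have s_herm: "hermitian (s y)" for y
    unfolding hermitian_def s_wave by (simp add: cnj_wave_minus f(3))
  have s_le: "cmod (s y l) \<le> cmod (S l)" for y l
    by (simp add: s_wave S_def norm_mult norm_divide)
  have V_eq: "AE \<omega> in M. complex_of_real (V y \<omega>) = I (s y) \<omega>" for y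
    unfolding V_def s_def using v_version by blast
  note fubini = noise_fubini[OF e s_meas s_herm S s_le \<Phi>_eq \<Phi> V_meas V_eq]
  have Ym [measurable]: "Y \<in> borel_measurable M" unfolding Y_def[abs_def] by measurable
  have Y: "AE \<omega> in M. Y \<omega> = (\<integral>y. d y \<partial>lborel) + Re (I \<Phi> \<omega>)"
    using fubini by eventually_elim (simp add: Y_def d)
  have "expectation Y = expectation (\<lambda>\<omega>. (\<integral>y. d y \<partial>lborel) + Re (I \<Phi> \<omega>))"
    using Y measurable_noise[OF \<Phi>(1)] by (intro integral_cong_AE) auto
  also have "\<dots> = (\<integral>y. d y \<partial>lborel)"
  proof -
    have "integrable M (\<lambda>\<omega>. Re (I \<Phi> \<omega>))"
      using measurable_noise[OF \<Phi>(1)]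
      by (intro square_integrable_imp_integrable[OF _ integrable_Re_noise_sq[OF \<Phi>(1)]]) measurable
    then show ?thesis using noise_mean[OF \<Phi>(1)] by (simp add: prob_space)
  qed
  finally have EY: "expectation Y = (\<integral>y. d y \<partial>lborel)" .
  show "Ubar M m \<mu> k v \<epsilon> t x \<in> borel_measurable M"
    unfolding Ubar_eq[abs_def] by measurable
  show "AE \<omega> in M. Ubar M m \<mu> k v \<epsilon> t x \<omega> = Re (I (\<lambda>l. complex_of_real (\<epsilon> powr (-1/4)) *
           averaged_kernel \<mu> k (specdens n A w \<kappa>) (\<epsilon> powr (-1/2)) t x l) \<omega>)"
    unfolding f_def[symmetric] c_def[symmetric] \<Phi>_def[symmetric]
    using Y noise_scale[OF \<Phi>(1), of "complex_of_real (\<epsilon> powr (-1/4))"]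
    by eventually_elim (simp add: Ubar_eq EY)
qed

section \<open>The limit field and its covariance\<close>

lemma sq_integrable_gaussian_wave: "sq_integrable (\<lambda>l. wave \<mu> k t x l * complex_of_real (exp (- l\<^sup>2 / 4)))"
proof (rule sq_integrableI_bound)
  show "integrable lborel (\<lambda>l. exp (- (1 / 2 * l\<^sup>2)) :: real)" by (rule integrable_gaussian) simp
qed (auto simp: norm_mult exp_double[symmetric])

lemma hermitian_gaussian_wave: "hermitian (\<lambda>l. wave \<mu> k t x l * complex_of_real (exp (- l\<^sup>2 / 4)))"
  by (simp add: hermitian_def cnj_wave_minus)

lemma U0_eq_wave:
  "U0 I \<mu> k n A w \<kappa> t x = (\<lambda>\<omega>. complex_of_real (sqrt (constC n A w \<kappa>) / (2 * sqrt pi)) *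
     I (\<lambda>l. wave \<mu> k t x l * complex_of_real (exp (- l\<^sup>2 / 4))) \<omega>)"
  by (simp only: U0_def wave_def)

lemma (in white_noise) covar_U0:
  assumes C: "0 \<le> constC n A w \<kappa>"
  shows "expectation (\<lambda>\<omega>. Re (U0 I \<mu> k n A w \<kappa> t x \<omega>)) = 0"
    and "covar M (\<lambda>\<omega>. Re (U0 I \<mu> k n A w \<kappa> t x \<omega>)) (\<lambda>\<omega>. Re (U0 I \<mu> k n A w \<kappa> t' x' \<omega>))
            = constC n A w \<kappa> / (4 * pi) *
              (\<integral>l. cos (l * (x - x') + \<mu> * (-1) ^ k * (t - t') * l ^ (2 * k + 1)) * exp (- l\<^sup>2 / 2) \<partial>lborel)"
proof -
  define a where "a = sqrt (constC n A w \<kappa>) / (2 * sqrt pi)"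
  define g where "g t x l = wave \<mu> k t x l * complex_of_real (exp (- l\<^sup>2 / 4))" for t x l
  have g: "sq_integrable (g t x)" "hermitian (g t x)" for t x
    unfolding g_def by (rule sq_integrable_gaussian_wave hermitian_gaussian_wave)+
  have Re_U0: "Re (U0 I \<mu> k n A w \<kappa> t x \<omega>) = a * Re (I (g t x) \<omega>)" for t x \<omega>
    by (simp only: U0_eq_wave a_def[symmetric] g_def[abs_def] Re_complex_of_real Im_complex_of_real times_complex.sel)
  have mean: "expectation (\<lambda>\<omega>. Re (U0 I \<mu> k n A w \<kappa> t x \<omega>)) = 0" for t x
    unfolding Re_U0 by (simp add: noise_mean[OF g(1)])
  show "expectation (\<lambda>\<omega>. Re (U0 I \<mu> k n A w \<kappa> t x \<omega>)) = 0" by (rule mean)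
  let ?\<theta> = "\<lambda>l. l * (x - x') + \<mu> * (-1) ^ k * (t - t') * l ^ (2 * k + 1)"
  have prod: "g t x l * cnj (g t' x' l) = exp (\<i> * complex_of_real (?\<theta> l)) * complex_of_real (exp (- l\<^sup>2 / 2))" for l
  proof -
    have "g t x l * cnj (g t' x' l) = (wave \<mu> k t x l * cnj (wave \<mu> k t' x' l)) * complex_of_real (exp (- l\<^sup>2 / 4) * exp (- l\<^sup>2 / 4))"
      by (simp add: g_def)
    also have "exp (- l\<^sup>2 / 4) * exp (- l\<^sup>2 / 4) = exp (- l\<^sup>2 / 2)" by (simp add: exp_add[symmetric])
    finally show ?thesis by (simp only: wave_cnj_wave)
  qed
  have int: "integrable lborel (\<lambda>l. g t x l * cnj (g t' x' l))"
    using g(1)[of t x] g(1)[of t' x'] by (intro integrable_mult_of_squares) (auto simp: sq_integrable_def)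
  have "covar M (\<lambda>\<omega>. Re (U0 I \<mu> k n A w \<kappa> t x \<omega>)) (\<lambda>\<omega>. Re (U0 I \<mu> k n A w \<kappa> t' x' \<omega>))
      = expectation (\<lambda>\<omega>. a\<^sup>2 * (Re (I (g t x) \<omega>) * Re (I (g t' x') \<omega>)))"
    unfolding covar_def mean unfolding Re_U0 by (simp add: power2_eq_square mult_ac)
  also have "\<dots> = a\<^sup>2 * Re (\<integral>l. g t x l * cnj (g t' x' l) \<partial>lborel)"
    by (simp add: noise_covariance[OF g g])
  \<comment> \<open>Taking the real part under the integral leaves the cosine of the phase
    difference.\<close>
  also have "Re (\<integral>l. g t x l * cnj (g t' x' l) \<partial>lborel) = (\<integral>l. Re (g t x l * cnj (g t' x' l)) \<partial>lborel)"
    by (rule integral_Re[OF int, symmetric])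
  also have "\<dots> = (\<integral>l. cos (?\<theta> l) * exp (- l\<^sup>2 / 2) \<partial>lborel)"
    unfolding prod cis_conv_exp[symmetric] by simp
  also have "a\<^sup>2 = constC n A w \<kappa> / (4 * pi)" using C by (simp add: a_def power_divide power_mult_distrib)
  finally show "covar M (\<lambda>\<omega>. Re (U0 I \<mu> k n A w \<kappa> t x \<omega>)) (\<lambda>\<omega>. Re (U0 I \<mu> k n A w \<kappa> t' x' \<omega>))
            = constC n A w \<kappa> / (4 * pi) *
              (\<integral>l. cos (?\<theta> l) * exp (- l\<^sup>2 / 2) \<partial>lborel)" .
qed

theorem theorem4:
  fixes P :: "'w measure" and Wint :: "(real \<Rightarrow> complex) \<Rightarrow> 'w \<Rightarrow> complex"
    and M :: "real \<Rightarrow> real" and k n :: nat and \<mu> :: real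
    and A w \<kappa> :: "nat \<Rightarrow> real"
    and v :: "real \<Rightarrow> real \<Rightarrow> 'w \<Rightarrow> real"
    and ts xs :: "'i::finite \<Rightarrow> real"
  assumes P: "prob_space P" "complete_measure P"
    and W: "complex_white_noise_integral P Wint"
    and mu: "\<mu> \<in> {-1, 1}"
    and A_nonneg: "\<forall>j\<le>n. A j \<ge> 0" and A_sum: "(\<Sum>j=0..n. A j) = 1" and A0: "A 0 = 0"
    and w0: "w 0 = 0" and wj: "\<forall>j. 1 \<le> j \<and> j \<le> n \<longrightarrow> w j \<noteq> 0"
    and kappa: "\<forall>j\<le>n. 0 < \<kappa> j \<and> \<kappa> j < 1"
    and v_meas: "\<forall>t. (\<lambda>(x, \<omega>). v t x \<omega>) \<in> borel_measurable (lborel \<Otimes>\<^sub>M P)"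
    and v_version: "\<forall>t x. AE \<omega> in P. complex_of_real (v t x \<omega>) = Wint (solker \<mu> k n A w \<kappa> t x) \<omega>"
    and M_int: "\<forall>s c x. c > 0 \<longrightarrow>
                  integrable lborel (\<lambda>x1. exp (- (x1 - x)\<^sup>2) * Re (detpart M \<mu> k s (c * x1)))"
    and ts_pos: "\<forall>i. ts i > 0"
  shows "weak_conv_vec
           (\<lambda>\<epsilon>. distr P borel (\<lambda>\<omega>. \<chi> i. Ubar P M \<mu> k v \<epsilon> (ts i) (xs i) \<omega>))
           (distr P borel (\<lambda>\<omega>. \<chi> i. Re (U0 Wint \<mu> k n A w \<kappa> (ts i) (xs i) \<omega>)))
           (at_right 0)
       \<and> (\<forall>t x. integral\<^sup>L P (\<lambda>\<omega>. Re (U0 Wint \<mu> k n A w \<kappa> t x \<omega>)) = 0)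
       \<and> (\<forall>t x t' x'. covar P (\<lambda>\<omega>. Re (U0 Wint \<mu> k n A w \<kappa> t x \<omega>))
                              (\<lambda>\<omega>. Re (U0 Wint \<mu> k n A w \<kappa> t' x' \<omega>))
            = constC n A w \<kappa> / (4 * pi) *
              (\<integral>l. cos (l * (x - x') + \<mu> * (-1) ^ k * (t - t') * l ^ (2 * k + 1)) * exp (- l\<^sup>2 / 2) \<partial>lborel))"
proof -
  interpret prob_space P by fact
  interpret white_noise P Wint by standard fact
  define f where "f = specdens n A w \<kappa>"
  have f: "integrable lborel f" "\<And>l. 0 \<le> f l" "\<And>l. f (- l) = f l" "isCont f 0"
    unfolding f_def using A_nonneg kappa A0 wj
    by (auto intro: integrable_specdens specdens_nonneg specdens_minus isCont_specdens_0)
  \<comment> \<open>The dilation limit produces \<open>f 0\<close>; this identifies it with the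
    constant of the limit field.\<close>
  have f0: "f 0 = constC n A w \<kappa>" unfolding f_def by (rule specdens_0) (rule A0)
  define \<phi> where "\<phi> \<epsilon> i l = complex_of_real (\<epsilon> powr (-1/4)) *
      averaged_kernel \<mu> k f (\<epsilon> powr (-1/2)) (ts i) (xs i) l" for \<epsilon> i l
  define g where "g i l = wave \<mu> k (ts i) (xs i) l * complex_of_real (exp (- l\<^sup>2 / 4))" for i l
  define \<psi> where "\<psi> i l = complex_of_real (sqrt (f 0) / (2 * sqrt pi)) * g i l" for i l
  have \<phi>: "sq_integrable (\<phi> \<epsilon> i)" "hermitian (\<phi> \<epsilon> i)" for \<epsilon> i
    unfolding \<phi>_def
    using sq_integrable_averaged_kernel[of f, OF f(1,2)] hermitian_averaged_kernel[of f, OF f(3)]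
    by (auto intro: sq_integrable_mult_const simp: hermitian_def)
  have g: "sq_integrable (g i)" "hermitian (g i)" for i
    unfolding g_def by (rule sq_integrable_gaussian_wave hermitian_gaussian_wave)+
  have \<psi>: "sq_integrable (\<psi> i)" "hermitian (\<psi> i)" for i
    unfolding \<psi>_def using sq_integrable_mult_const[OF g(1)] g(2) by (simp_all only: hermitian_def) simp
  have "weak_conv_vec (\<lambda>\<epsilon>. distr P borel (\<lambda>\<omega>. \<chi> i. Re (Wint (\<phi> \<epsilon> i) \<omega>)))
      (distr P borel (\<lambda>\<omega>. \<chi> i. Re (Wint (\<psi> i) \<omega>))) (at_right 0)"
    unfolding \<phi>_def \<psi>_def g_def
    by (rule weak_conv_vec_noise[OF \<phi>[unfolded \<phi>_def] \<psi>[unfolded \<psi>_def g_def]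
          tendsto_integral_averaged_kernels[OF f(1,2,4)]])
  moreover have "\<forall>\<^sub>F \<epsilon> in at_right 0. distr P borel (\<lambda>\<omega>. \<chi> i. Ubar P M \<mu> k v \<epsilon> (ts i) (xs i) \<omega>)
      = distr P borel (\<lambda>\<omega>. \<chi> i. Re (Wint (\<phi> \<epsilon> i) \<omega>))"
    using eventually_at_right_less[of 0]
  proof eventually_elim
    case (elim \<epsilon>)
    note U = Ubar_eq_noise[OF A_nonneg kappa v_meas v_version M_int elim]
    \<comment> \<open>There are finitely many indices, so their exceptional null sets merge into
      one.\<close>
    have "AE \<omega> in P. \<forall>i. Ubar P M \<mu> k v \<epsilon> (ts i) (xs i) \<omega> = Re (Wint (\<phi> \<epsilon> i) \<omega>)"
      unfolding \<phi>_def f_def AE_all_countable by (intro allI U(2))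
    then have "AE \<omega> in P. (\<chi> i. Ubar P M \<mu> k v \<epsilon> (ts i) (xs i) \<omega>) = (\<chi> i. Re (Wint (\<phi> \<epsilon> i) \<omega>))"
      by eventually_elim (simp add: vec_eq_iff)
    moreover have "(\<lambda>\<omega>. \<chi> i. Ubar P M \<mu> k v \<epsilon> (ts i) (xs i) \<omega>) \<in> borel_measurable P"
      using U(1) by (subst borel_measurable_euclidean_space) (auto simp: Basis_vec_def inner_axis)
    ultimately show ?case
      using measurable_noise_vec[of "\<phi> \<epsilon>", OF \<phi>(1)] by (intro distr_cong_AE) auto
  qed
  ultimately have "weak_conv_vec (\<lambda>\<epsilon>. distr P borel (\<lambda>\<omega>. \<chi> i. Ubar P M \<mu> k v \<epsilon> (ts i) (xs i) \<omega>))
      (distr P borel (\<lambda>\<omega>. \<chi> i. Re (Wint (\<psi> i) \<omega>))) (at_right 0)"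
    by (rule weak_conv_vec_cong)
  \<comment> \<open>In \<open>U0\<close> the constant stands outside the noise integral, in \<psi>
    inside; linearity makes the two agree almost surely, which suffices for the laws.\<close>
  moreover have "distr P borel (\<lambda>\<omega>. \<chi> i. Re (U0 Wint \<mu> k n A w \<kappa> (ts i) (xs i) \<omega>))
      = distr P borel (\<lambda>\<omega>. \<chi> i. Re (Wint (\<psi> i) \<omega>))"
  proof -
    have U0_g: "U0 Wint \<mu> k n A w \<kappa> (ts i) (xs i) \<omega> = complex_of_real (sqrt (f 0) / (2 * sqrt pi)) * Wint (g i) \<omega>" for i \<omega>
      by (simp only: U0_eq_wave f0 g_def[abs_def])
    have eq: "AE \<omega> in P. \<forall>i. U0 Wint \<mu> k n A w \<kappa> (ts i) (xs i) \<omega> = Wint (\<psi> i) \<omega>"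
      unfolding U0_g \<psi>_def AE_all_countable by (intro allI eventually_mono[OF noise_scale[OF g(1)]]) (rule sym)
    then have "AE \<omega> in P. (\<chi> i. Re (U0 Wint \<mu> k n A w \<kappa> (ts i) (xs i) \<omega>)) = (\<chi> i. Re (Wint (\<psi> i) \<omega>))"
      by eventually_elim simp
    moreover have "(\<lambda>\<omega>. \<chi> i. Re (U0 Wint \<mu> k n A w \<kappa> (ts i) (xs i) \<omega>)) \<in> borel_measurable P"
      unfolding U0_g using measurable_noise[OF g(1)]
      by (subst borel_measurable_euclidean_space) (auto simp: Basis_vec_def inner_axis)
    ultimately show ?thesis
      using measurable_noise_vec[of \<psi>, OF \<psi>(1)] by (intro distr_cong_AE) auto
  qed
  ultimately show ?thesis
    by (intro conjI allI covar_U0 constC_nonneg A_nonneg kappa) (simp only:)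
qed

end
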